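(* For each pair of positive integers $m,k$, let $G=\mathbb Z/m\mathbb Z\times\mathbb Z/mk\mathbb Z$. Then \[ \frac{K(G)\cdot|G|}{|\mathrm{Aut}(G)|}=\prod_\ell\left(\lim_{e\to\infty}\frac{\ell^e\cdot\#\left\{\sigma\in\mathrm{GL}_2(\mathbb Z/\ell^e\mathbb Z):\begin{array}{l}\det(\sigma)+1-\mathrm{tr}(\sigma)\equiv|G|\pmod{\ell^e},\\ \sigma\equiv I\pmod{\ell^{\nu_\ell(m)}},\\ \sigma\not\equiv I\pmod{\ell^{\nu_\ell(m)+1}}\end{array}\right\}}{\#\mathrm{GL}_2(\mathbb Z/\ell^e\mathbb Z)}\right), \] the product over all primes $\ell$. Furthermore, for each $\ell$ the sequence whose limit is taken is constant for $e>\nu_\ell(|G|)$.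
   Context: $I$ is the $2\times2$ identity matrix, $\nu_\ell$ the $\ell$-adic valuation, $\mathrm{Aut}(G)$ the automorphism group of $G$ as an abstract group. With $N=|G|=m^2k$, \[ K(G)=\prod_{\ell\nmid N}\left(1-\frac{\left(\frac{N-1}{\ell}\right)^2\ell+1}{(\ell-1)^2(\ell+1)}\right)\prod_{\ell\mid m}\left(1-\frac1{\ell^2}\right)\prod_{\substack{\ell\mid k\\ \ell\nmid m}}\left(1-\frac1{\ell(\ell-1)}\right), \] products over primes, $\left(\frac\cdot\ell\right)$ the Kronecker symbol. *)

theory Defs
  imports
    "HOL-Analysis.Analysis"
    "HOL-Algebra.Bij"
    "HOL-Algebra.Elementary_Groups"
    "HOL-Number_Theory.Number_Theory"
begin

definition rank2_group :: "nat \<Rightarrow> nat \<Rightarrow> (int \<times> int) monoid" where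
  "rank2_group m k = integer_mod_group m \<times>\<times> integer_mod_group (m * k)"

lemma order_rank2_group:
  assumes "m > 0" "k > 0"
  shows "order (rank2_group m k) = m\<^sup>2 * k"
  using assms
  by (simp add: rank2_group_def order_def carrier_integer_mod_group card_cartesian_product
      power2_eq_square nat_mult_distrib)

(* The Kronecker symbol for a prime lower argument.  The library's Legendre symbol is not the
   Kronecker symbol at 2 (it would be 1 at every odd a). *)
definition kronecker_prime :: "int \<Rightarrow> nat \<Rightarrow> int" where
  "kronecker_prime a l =
     (if l = 2 then (if even a then 0 else if a mod 8 \<in> {1, 7} then 1 else - 1)
      else Legendre a (int l))"

(* The first product is infinite; an infinite product over primes is an infinite product over the
   naturals in which every non-prime index contributes the factor 1. *)
definition K_const :: "nat \<Rightarrow> nat \<Rightarrow> real" where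
  "K_const m k =
     (let N = order (rank2_group m k) in
       prodinf (\<lambda>l. if prime l \<and> \<not> l dvd N
                    then 1 - ((of_int (kronecker_prime (int N - 1) l))\<^sup>2 * real l + 1)
                             / ((real l - 1)\<^sup>2 * (real l + 1))
                    else 1)
       * (\<Prod>l | prime l \<and> l dvd m. 1 - 1 / (real l)\<^sup>2)
       * (\<Prod>l | prime l \<and> l dvd k \<and> \<not> l dvd m. 1 - 1 / (real l * (real l - 1))))"

(* The multiplicative monoid of M_2(Z/nZ), n > 0, on matrices of least nonnegative residues
   (as in integer_mod_group). *)
definition mat2_mod :: "nat \<Rightarrow> (int^2^2) monoid" where
  "mat2_mod n =
     \<lparr>carrier = {A. \<forall>i j. A $ i $ j \<in> {0..<int n}},
      mult = (\<lambda>A B. \<chi> i j. (A ** B) $ i $ j mod int n),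
      one = (\<chi> i j. (mat 1 :: int^2^2) $ i $ j mod int n)\<rparr>"

definition GL2 :: "nat \<Rightarrow> (int^2^2) monoid" where
  "GL2 n = units_of (mat2_mod n)"

definition mat_cong :: "int^2^2 \<Rightarrow> int^2^2 \<Rightarrow> nat \<Rightarrow> bool" where
  "mat_cong A B n \<longleftrightarrow> (\<forall>i j. [A $ i $ j = B $ i $ j] (mod int n))"

(* The congruences modulo powers of l are tested on the chosen representatives; they depend only on
   the class of \<sigma> modulo l^e as soon as e > multiplicity l m. *)
definition matrix_density :: "nat \<Rightarrow> nat \<Rightarrow> nat \<Rightarrow> nat \<Rightarrow> real" where
  "matrix_density m k l e =
     real (l ^ e) *
     real (card {\<sigma> \<in> carrier (GL2 (l ^ e)).
        [det \<sigma> + 1 - trace \<sigma> = int (order (rank2_group m k))] (mod int (l ^ e)) \<and>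
        mat_cong \<sigma> (mat 1) (l ^ multiplicity l m) \<and>
        \<not> mat_cong \<sigma> (mat 1) (l ^ (multiplicity l m + 1))})
     / real (order (GL2 (l ^ e)))"

lemma monoid_mat2_mod:
  assumes "n > 0"
  shows "monoid (mat2_mod n)"
proof (rule monoidI)
  let ?N = "int n"
  have L: "((x mod ?N) * c + (y mod ?N) * d) mod ?N = (x * c + y * d) mod ?N" for x y c d
    by (intro mod_add_cong mod_mult_left_eq)
  have R: "(c * (x mod ?N) + d * (y mod ?N)) mod ?N = (c * x + d * y) mod ?N" for x y c d
    by (intro mod_add_cong mod_mult_right_eq)
  fix A B C
  show "(A \<otimes>\<^bsub>mat2_mod n\<^esub> B) \<otimes>\<^bsub>mat2_mod n\<^esub> C = A \<otimes>\<^bsub>mat2_mod n\<^esub> (B \<otimes>\<^bsub>mat2_mod n\<^esub> C)"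
    by (simp add: mat2_mod_def vec_eq_iff matrix_matrix_mult_def sum_2 L R)
      (simp add: algebra_simps)
  show "\<one>\<^bsub>mat2_mod n\<^esub> \<otimes>\<^bsub>mat2_mod n\<^esub> A = A" if "A \<in> carrier (mat2_mod n)"
    using that by (simp add: mat2_mod_def vec_eq_iff matrix_matrix_mult_def sum_2 L mat_def
        forall_2)
  show "A \<otimes>\<^bsub>mat2_mod n\<^esub> \<one>\<^bsub>mat2_mod n\<^esub> = A" if "A \<in> carrier (mat2_mod n)"
    using that by (simp add: mat2_mod_def vec_eq_iff matrix_matrix_mult_def sum_2 R mat_def
        forall_2)
qed (use assms in \<open>auto simp: mat2_mod_def\<close>)

lemma group_GL2: "n > 0 \<Longrightarrow> group (GL2 n)"
  unfolding GL2_def by (rule monoid.units_group[OF monoid_mat2_mod])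

lemma kronecker_prime_sq:
  assumes "prime l"
  shows "(kronecker_prime a l)\<^sup>2 = (if int l dvd a then 0 else 1)"
  using assms by (auto simp: kronecker_prime_def Legendre_def cong_0_iff)

lemma convergent_K_const:
  fixes N :: nat
  shows "convergent_prod (\<lambda>l. if prime l \<and> \<not> l dvd N
            then 1 - ((of_int (kronecker_prime (int N - 1) l))\<^sup>2 * real l + 1)
                     / ((real l - 1)\<^sup>2 * (real l + 1))
            else 1)"
proof -
  define c :: "nat \<Rightarrow> real" where "c l = (of_int (kronecker_prime (int N - 1) l))\<^sup>2" for l
  define f where "f l = (if prime l \<and> \<not> l dvd N
     then 1 - (c l * real l + 1) / ((real l - 1)\<^sup>2 * (real l + 1)) else 1)" for l
  have bound: "norm (norm (f l - 1)) \<le> 4 * inverse (real l ^ 2)" if "l \<ge> 2" for l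
  proof (cases "prime l \<and> \<not> l dvd N")
    case True
    have l: "real l \<ge> 2" using that by simp
    have "c l = of_int ((kronecker_prime (int N - 1) l)\<^sup>2)"
      by (simp add: c_def)
    then have c: "0 \<le> c l" "c l \<le> 1"
      using kronecker_prime_sq[of l "int N - 1"] True by (simp_all split: if_splits)
    define x where "x = (c l * real l + 1) / ((real l - 1)\<^sup>2 * (real l + 1))"
    have "x \<le> (1 * real l + 1) / ((real l - 1)\<^sup>2 * (real l + 1))"
      unfolding x_def using c l by (intro divide_right_mono add_right_mono mult_right_mono) simp_all
    also have "\<dots> = 1 / (real l - 1)\<^sup>2" using l by (simp add: divide_simps)
    also have "\<dots> \<le> 1 / (real l / 2)\<^sup>2"
      using l by (intro divide_left_mono power_mono mult_pos_pos zero_less_power) simp_all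
    also have "\<dots> = 4 * inverse (real l ^ 2)" using l by (simp add: power_divide inverse_eq_divide)
    finally have "x \<le> 4 * inverse (real l ^ 2)" .
    moreover have "x \<ge> 0" unfolding x_def using c l by simp
    moreover have "f l - 1 = - x" using True unfolding x_def f_def by simp
    ultimately show ?thesis by simp
  next
    case False
    then have "f l = 1" unfolding f_def by (rule if_not_P)
    then show ?thesis by simp
  qed
  have "summable (\<lambda>l. 4 * inverse (real l ^ 2))"
    by (intro summable_mult inverse_power_summable) simp
  then have "summable (\<lambda>l. norm (f l - 1))"
    using bound by (rule summable_comparison_test'[where N = 2])
  then have "convergent_prod f"
    by (intro abs_convergent_prod_imp_convergent_prod summable_imp_abs_convergent_prod)
  then show ?thesis
    unfolding f_def c_def .
qed

end

theory Submission
  imports Defs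
begin

text \<open>
  Fix a prime \<open>l\<close> and put \<open>a = v(m)\<close>, \<open>b = v(k)\<close>, \<open>N = m\<^sup>2 k\<close>, \<open>v\<close> the \<open>l\<close>-adic valuation.
  Since \<open>det \<sigma> + 1 - tr \<sigma> = det (\<sigma> - I)\<close>, writing \<open>\<sigma> = I + l\<^sup>a \<tau>\<close> turns the congruences on \<open>\<sigma>\<close> into
  \<open>det \<tau> = N / l\<^sup>2\<^sup>a\<close> modulo \<open>l ^ (e - 2 a)\<close> with \<open>\<tau> \<noteq> 0\<close> modulo \<open>l\<close>. The determinant has non-zero
  differential at such a \<open>\<tau>\<close>, so each solution has exactly \<open>l\<^sup>3\<close> lifts from one level to the next; the sequence
  is constant once \<open>e > 2 a + b\<close>, and its value is a count of \<open>2 \<times> 2\<close> matrices modulo \<open>l\<close>.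

  On the group side an endomorphism is \<open>(x, y) \<mapsto> (\<alpha> x + \<beta> y, k \<gamma> x + \<delta> y)\<close> with \<open>\<alpha>, \<beta>, \<gamma>\<close> modulo \<open>m\<close> and
  \<open>\<delta>\<close> modulo \<open>m k\<close>, and it is bijective iff for every prime \<open>l\<close> dividing \<open>m k\<close> we have
  \<open>l \<nmid> \<alpha> \<delta> - k \<beta> \<gamma>\<close> (if \<open>l\<close> divides \<open>m\<close>) or \<open>l \<nmid> \<delta>\<close> (otherwise). By the Chinese remainder theorem the number of
  such matrices is again a product of counts modulo \<open>l\<close>, and the two sides agree prime by prime.
\<close>

section \<open>Matrices of residues\<close>

definition mats :: "nat \<Rightarrow> (int^2^2) set" where
  "mats n = {A. \<forall>i j. A $ i $ j \<in> {0..<int n}}"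

definition mat22 :: "int \<Rightarrow> int \<Rightarrow> int \<Rightarrow> int \<Rightarrow> int^2^2" where
  "mat22 a b c d = vector [vector [a, b], vector [c, d]]"

definition mred :: "nat \<Rightarrow> int^2^2 \<Rightarrow> int^2^2" where
  "mred n A = (\<chi> i j. A $ i $ j mod int n)"

text \<open>Serves twice: with \<open>A\<close> in \<open>mats n\<close> it is the expansion of a
  matrix in base \<open>n\<close>, with \<open>A = mat 1\<close> it parametrises the matrices
  congruent to the identity modulo \<open>n\<close>.\<close>

definition mlift :: "nat \<Rightarrow> int^2^2 \<Rightarrow> int^2^2 \<Rightarrow> int^2^2" where
  "mlift n A X = (\<chi> i j. A $ i $ j + int n * X $ i $ j)"

lemma carrier_mat2_mod: "carrier (mat2_mod n) = mats n"
  by (simp add: mat2_mod_def mats_def)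

lemma mat22_nth [simp]:
  "mat22 a b c d $ 1 $ 1 = a" "mat22 a b c d $ 1 $ 2 = b"
  "mat22 a b c d $ 2 $ 1 = c" "mat22 a b c d $ 2 $ 2 = d"
  by (simp_all add: mat22_def)

lemma mred_nth [simp]: "mred n A $ i $ j = A $ i $ j mod int n"
  by (simp add: mred_def)

lemma mlift_nth [simp]: "mlift n A X $ i $ j = A $ i $ j + int n * X $ i $ j"
  by (simp add: mlift_def)

lemma mat_eq_iff_nth: "A = B \<longleftrightarrow> (\<forall>i j. A $ i $ j = (B $ i $ j :: int))"
  by (simp add: vec_eq_iff)

lemma mred_in_mats [simp]: "n > 0 \<Longrightarrow> mred n A \<in> mats n"
  by (simp add: mats_def)

lemma mred_ident: "A \<in> mats n \<Longrightarrow> mred n A = A"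
  by (simp add: mats_def mat_eq_iff_nth)

lemma bij_mat22:
  "bij_betw (\<lambda>(a, b, c, d). mat22 a b c d)
     ({0..<int n} \<times> {0..<int n} \<times> {0..<int n} \<times> {0..<int n}) (mats n)"
proof (rule bij_betwI[where g = "\<lambda>A. (A $ 1 $ 1, A $ 1 $ 2, A $ 2 $ 1, A $ 2 $ 2)"], goal_cases)
  case 1 show ?case by (auto simp: mats_def forall_2)
next
  case 2 show ?case by (auto simp: mats_def)
next
  case 3 then show ?case by (auto split: prod.splits)
next
  case 4 then show ?case by (simp add: mat_eq_iff_nth forall_2)
qed

lemma finite_mats [simp]: "finite (mats n)"
  using bij_betw_finite[OF bij_mat22[of n]] by simp

lemma sum_mats:
  "sum f (mats n) = (\<Sum>a\<in>{0..<int n}. \<Sum>b\<in>{0..<int n}. \<Sum>c\<in>{0..<int n}. \<Sum>d\<in>{0..<int n}.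
     f (mat22 a b c d))"
  unfolding sum.reindex_bij_betw[OF bij_mat22[of n], of f, symmetric]
  by (simp add: sum.cartesian_product split_def)

lemma card_mats: "card (mats n) = n ^ 4"
proof -
  have "card (mats n) = (\<Sum>A\<in>mats n. 1)" by simp
  then show ?thesis
    unfolding sum_mats by (simp add: power4_eq_xxxx mult.assoc)
qed

section \<open>Base expansions and the Chinese remainder theorem for matrices\<close>

lemma bij_betw_of_card_eq:
  assumes "finite B" "inj_on f A" "f ` A \<subseteq> B" "card B = card A"
  shows "bij_betw f A B"
  using assms by (simp add: bij_betw_def card_image card_subset_eq)

text \<open>Division with remainder by \<open>n\<close> in every entry: reduction modulo
  \<open>n\<close> recovers the low digit and then the high one, and surjectivity follows from
  \<open>(n * d) ^ 4 = n ^ 4 * d ^ 4\<close>.\<close>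

lemma bij_mlift:
  assumes "n > 0"
  shows "bij_betw (\<lambda>(A, X). mlift n A X) (mats n \<times> mats d) (mats (n * d))"
proof -
  have inj: "inj_on (\<lambda>(A, X). mlift n A X) (mats n \<times> mats d)"
  proof (rule inj_onI, clarify)
    fix A X B Y assume A: "A \<in> mats n" "B \<in> mats n" and eq: "mlift n A X = mlift n B Y"
    have eq': "A $ i $ j + int n * X $ i $ j = B $ i $ j + int n * Y $ i $ j" for i j
      using eq by (simp add: mat_eq_iff_nth)
    have "A $ i $ j = B $ i $ j" for i j
      using A arg_cong[OF eq'[of i j], of "\<lambda>x. x mod int n"] by (simp add: mats_def)
    moreover from this have "X $ i $ j = Y $ i $ j" for i j
      using eq'[of i j] assms by simp
    ultimately show "A = B \<and> X = Y" by (simp add: mat_eq_iff_nth)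
  qed
  have bound: "0 \<le> x + int n * y \<and> x + int n * y < int n * int d"
    if "0 \<le> x" "x < int n" "0 \<le> y" "y < int d" for x y
  proof -
    have "x + int n * y < int n * (1 + y)"
      using that by (simp add: distrib_left)
    moreover have "int n * (1 + y) \<le> int n * int d"
      using that by (intro mult_left_mono) simp_all
    ultimately have "x + int n * y < int n * int d"
      by (rule less_le_trans)
    then show ?thesis
      using that by simp
  qed
  have "mlift n A X \<in> mats (n * d)" if "A \<in> mats n" "X \<in> mats d" for A X
    using that bound by (simp add: mats_def)
  then have "(\<lambda>(A, X). mlift n A X) ` (mats n \<times> mats d) \<subseteq> mats (n * d)"
    by auto
  moreover have "card (mats (n * d)) = card (mats n \<times> mats d)"
    by (simp add: card_cartesian_product card_mats power_mult_distrib)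
  ultimately show ?thesis
    using inj by (intro bij_betw_of_card_eq) auto
qed

lemma mred_mlift: "A \<in> mats n \<Longrightarrow> mred n (mlift n A X) = A"
  by (simp add: mats_def mat_eq_iff_nth)

lemma card_bij_Collect:
  assumes "bij_betw f A B"
  shows "card {y \<in> B. P y} = card {x \<in> A. P (f x)}"
proof -
  have "bij_betw f {x \<in> A. P (f x)} {y \<in> B. P y}"
    using assms by (auto simp: bij_betw_def inj_on_def)
  then show ?thesis by (simp add: bij_betw_same_card)
qed

text \<open>A condition on the low digits leaves all \<open>d ^ 4\<close> choices of high digits
  free.\<close>

lemma card_mred:
  assumes "n > 0"
  shows "card {X \<in> mats (n * d). P (mred n X)} = d ^ 4 * card {X \<in> mats n. P X}"
proof -
  have "{p \<in> mats n \<times> mats d. P (mred n (case p of (A, X) \<Rightarrow> mlift n A X))}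
      = {X \<in> mats n. P X} \<times> mats d"
    by (auto simp: mred_mlift)
  then show ?thesis
    unfolding card_bij_Collect[OF bij_mlift[OF assms]]
    by (simp add: card_cartesian_product card_mats)
qed

text \<open>The Chinese remainder theorem in each entry gives injectivity; equal cardinalities give
  the rest.\<close>

lemma bij_mred_coprime:
  assumes "coprime a b" "a > 0" "b > 0"
  shows "bij_betw (\<lambda>X. (mred a X, mred b X)) (mats (a * b)) (mats a \<times> mats b)"
proof -
  have inj: "inj_on (\<lambda>X. (mred a X, mred b X)) (mats (a * b))"
  proof (rule inj_onI, clarify)
    fix X Y assume XY: "X \<in> mats (a * b)" "Y \<in> mats (a * b)"
      and eq: "mred a X = mred a Y" "mred b X = mred b Y"
    have "X $ i $ j = Y $ i $ j" for i j
    proof -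
      have "[X $ i $ j = Y $ i $ j] (mod int a)" "[X $ i $ j = Y $ i $ j] (mod int b)"
        using eq by (simp_all add: mat_eq_iff_nth cong_def)
      then have "[X $ i $ j = Y $ i $ j] (mod int a * int b)"
        using assms(1) by (intro coprime_cong_mult) simp_all
      then show ?thesis
        using XY by (simp add: mats_def cong_def)
    qed
    then show "X = Y" by (simp add: mat_eq_iff_nth)
  qed
  moreover have "(\<lambda>X. (mred a X, mred b X)) ` mats (a * b) \<subseteq> mats a \<times> mats b"
    using assms by auto
  moreover have "card (mats (a * b)) = card (mats a \<times> mats b)"
    by (simp add: card_cartesian_product card_mats power_mult_distrib)
  ultimately show ?thesis
    by (intro bij_betw_of_card_eq) auto
qed

lemma card_mats_coprime:
  assumes "coprime a b" "a > 0" "b > 0"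
  shows "card {X \<in> mats (a * b). P (mred a X) \<and> Q (mred b X)}
       = card {X \<in> mats a. P X} * card {X \<in> mats b. Q X}"
proof -
  have "card {X \<in> mats (a * b). P (mred a X) \<and> Q (mred b X)}
      = card {p \<in> mats a \<times> mats b. P (fst p) \<and> Q (snd p)}"
    unfolding card_bij_Collect[OF bij_mred_coprime[OF assms]] by simp
  also have "{p \<in> mats a \<times> mats b. P (fst p) \<and> Q (snd p)}
      = {X \<in> mats a. P X} \<times> {X \<in> mats b. Q X}" by auto
  finally show ?thesis by (simp add: card_cartesian_product)
qed

lemma mred_mred: "n dvd k \<Longrightarrow> mred n (mred k X) = mred n X"
  by (simp add: mat_eq_iff_nth mod_mod_cancel)

text \<open>The Chinese remainder theorem splits off one prime at a time; the other conditions
  survive because they see \<open>X\<close> only through its reductions modulo the remaining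
  primes.\<close>

lemma card_mats_primes:
  assumes "finite S" "\<And>l. l \<in> S \<Longrightarrow> prime l"
  shows "card {X \<in> mats (\<Prod>S). \<forall>l\<in>S. P l (mred l X)} = (\<Prod>l\<in>S. card {X \<in> mats l. P l X})"
  using assms
proof (induction S)
  case empty
  then show ?case by (simp add: card_mats)
next
  case (insert p S)
  have "coprime p (\<Prod>S)"
    using insert by (intro prod_coprime_right) (metis insertCI primes_coprime)
  moreover have "p > 0" "\<Prod>S > 0"
    using insert.prems by (auto intro!: prod_pos simp: prime_gt_0_nat)
  moreover have "l dvd \<Prod>S" if "l \<in> S" for l
    using dvd_prodI[OF insert.hyps(1) that, of "\<lambda>l. l"] .
  then have "{X \<in> mats (\<Prod>(insert p S)). \<forall>l\<in>insert p S. P l (mred l X)}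
    = {X \<in> mats (p * \<Prod>S). P p (mred p X) \<and> (\<forall>l\<in>S. P l (mred l (mred (\<Prod>S) X)))}"
    using insert.hyps by (auto simp: mred_mred)
  moreover have "card {X \<in> mats (\<Prod>S). \<forall>l\<in>S. P l (mred l X)} = (\<Prod>l\<in>S. card {X \<in> mats l. P l X})"
    using insert.IH insert.prems by blast
  ultimately show ?case
    using insert.hyps card_mats_coprime[of p "\<Prod>S" "P p" "\<lambda>X. \<forall>l\<in>S. P l (mred l X)"]
    by simp
qed

text \<open>The conditions see \<open>X\<close> only modulo the radical \<open>R\<close> of
  \<open>M\<close>, so the proportion of good matrices modulo \<open>M\<close> is the product of the
  proportions modulo its prime divisors.\<close>

lemma card_mats_prime_divisors:
  assumes "M > 0"
  shows "real (card {X \<in> mats M. \<forall>l. prime l \<and> l dvd M \<longrightarrow> P l (mred l X)})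
       = real M ^ 4 * (\<Prod>l\<in>prime_factors M. real (card {X \<in> mats l. P l X}) / real l ^ 4)"
proof -
  let ?S = "prime_factors M"
  define R where "R = \<Prod>?S"
  have R: "R > 0"
    unfolding R_def using prime_gt_0_nat by (intro prod_pos) blast
  have M_eq: "M = (\<Prod>l\<in>?S. l ^ multiplicity l M)"
    using assms by (rule prime_factorization_nat)
  have "R dvd (\<Prod>l\<in>?S. l ^ multiplicity l M)"
    unfolding R_def by (rule prod_dvd_prod) (simp add: prime_factors_multiplicity dvd_power)
  with M_eq have "R dvd M" by simp
  then obtain d where M: "M = R * d" by blast
  have S: "prime l \<and> l dvd M \<longleftrightarrow> l \<in> ?S" for l
    using assms by (auto simp: in_prime_factors_iff)
  have "l dvd R" if "l \<in> ?S" for l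
    using dvd_prodI[OF _ that, of "\<lambda>l. l"] by (simp add: R_def)
  then have "(\<forall>l. prime l \<and> l dvd M \<longrightarrow> P l (mred l X)) \<longleftrightarrow> (\<forall>l\<in>?S. P l (mred l (mred R X)))" for X
    unfolding S by (metis mred_mred)
  then have "{X \<in> mats M. \<forall>l. prime l \<and> l dvd M \<longrightarrow> P l (mred l X)}
      = {X \<in> mats (R * d). \<forall>l\<in>?S. P l (mred l (mred R X))}"
    unfolding M by blast
  moreover have "card {X \<in> mats R. \<forall>l\<in>?S. P l (mred l X)} = (\<Prod>l\<in>?S. card {X \<in> mats l. P l X})"
    unfolding R_def by (rule card_mats_primes) auto
  ultimately have "card {X \<in> mats M. \<forall>l. prime l \<and> l dvd M \<longrightarrow> P l (mred l X)}
      = d ^ 4 * (\<Prod>l\<in>?S. card {X \<in> mats l. P l X})"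
    using card_mred[OF R, of d "\<lambda>X. \<forall>l\<in>?S. P l (mred l X)"] by simp
  moreover have "(\<Prod>l\<in>?S. real l ^ 4) = real R ^ 4"
    by (simp add: R_def prod_power_distrib)
  ultimately show ?thesis
    using R by (simp add: M prod_dividef power_mult_distrib del: prod_power_distrib)
qed

section \<open>Counting matrices modulo a prime\<close>

lemma det_cong_mred: "[det (mred n A) = det A] (mod int n)"
proof -
  have "[(A $ 1 $ 1 mod int n) * (A $ 2 $ 2 mod int n) - (A $ 1 $ 2 mod int n) * (A $ 2 $ 1 mod int n)
    = A $ 1 $ 1 * A $ 2 $ 2 - A $ 1 $ 2 * A $ 2 $ 1] (mod int n)"
    by (intro cong_diff cong_mult) (simp_all add: cong_def)
  then show ?thesis by (simp add: det_2)
qed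

section \<open>The units of the matrix monoid\<close>

lemma mult_mat2_mod: "A \<otimes>\<^bsub>mat2_mod n\<^esub> B = mred n (A ** B)"
  by (simp add: mat2_mod_def mred_def)

lemma one_mat2_mod: "\<one>\<^bsub>mat2_mod n\<^esub> = mred n (mat 1)"
  by (simp add: mat2_mod_def mred_def)

lemma carrier_GL2:
  assumes "n > 0"
  shows "carrier (GL2 n) = {A \<in> mats n. coprime (det A) (int n)}"
proof (intro equalityI subsetI)
  fix A assume "A \<in> carrier (GL2 n)"
  then obtain B where A: "A \<in> mats n" and "mred n (A ** B) = mred n (mat 1)"
    by (auto simp: GL2_def units_of_def Units_def carrier_mat2_mod mult_mat2_mod one_mat2_mod)
  then have "[det (A ** B) = det (mat 1 :: int^2^2)] (mod int n)"
    by (metis cong_sym cong_trans det_cong_mred)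
  then have "[det A * det B = 1] (mod int n)"
    by (simp add: det_mul)
  then show "A \<in> {A \<in> mats n. coprime (det A) (int n)}"
    using A by (auto simp: coprime_iff_invertible_int)
next
  fix A assume "A \<in> {A \<in> mats n. coprime (det A) (int n)}"
  then obtain u where A: "A \<in> mats n" and u: "[det A * u = 1] (mod int n)"
    by (auto simp: coprime_iff_invertible_int)
  \<comment> \<open>The adjugate of \<open>A\<close> times an inverse \<open>u\<close> of its
    determinant.\<close>
  define C where "C = mat22 (u * A $ 2 $ 2) (- u * A $ 1 $ 2) (- u * A $ 2 $ 1) (u * A $ 1 $ 1)"
  define B where "B = mred n C"
  have B: "B \<in> mats n" using assms by (simp add: B_def)
  have eq: "[A $ i $ 1 * B $ 1 $ j + A $ i $ 2 * B $ 2 $ j = (mat 1 :: int^2^2) $ i $ j] (mod int n)"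
           "[B $ i $ 1 * A $ 1 $ j + B $ i $ 2 * A $ 2 $ j = (mat 1 :: int^2^2) $ i $ j] (mod int n)" for i j
  proof -
    have B_cong: "[B $ i $ j = C $ i $ j] (mod int n)" for i j
      by (simp add: B_def cong_def)
    have ij: "i = 1 \<or> i = 2" "j = 1 \<or> j = 2" using exhaust_2 by blast+
    have "[A $ i $ 1 * B $ 1 $ j + A $ i $ 2 * B $ 2 $ j = A $ i $ 1 * C $ 1 $ j + A $ i $ 2 * C $ 2 $ j] (mod int n)"
      "[B $ i $ 1 * A $ 1 $ j + B $ i $ 2 * A $ 2 $ j = C $ i $ 1 * A $ 1 $ j + C $ i $ 2 * A $ 2 $ j] (mod int n)"
      by (intro cong_add cong_mult B_cong cong_refl)+
    moreover have "A $ i $ 1 * C $ 1 $ j + A $ i $ 2 * C $ 2 $ j = (det A * u) * (mat 1 :: int^2^2) $ i $ j"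
      "C $ i $ 1 * A $ 1 $ j + C $ i $ 2 * A $ 2 $ j = (det A * u) * (mat 1 :: int^2^2) $ i $ j"
      using ij by (auto simp: C_def det_2 mat_def algebra_simps)
    moreover have "[(det A * u) * (mat 1 :: int^2^2) $ i $ j = 1 * (mat 1 :: int^2^2) $ i $ j] (mod int n)"
      using u by (rule cong_scalar_right)
    ultimately show "[A $ i $ 1 * B $ 1 $ j + A $ i $ 2 * B $ 2 $ j = (mat 1 :: int^2^2) $ i $ j] (mod int n)"
       "[B $ i $ 1 * A $ 1 $ j + B $ i $ 2 * A $ 2 $ j = (mat 1 :: int^2^2) $ i $ j] (mod int n)"
      by (simp_all add: cong_def)
  qed
  have "mred n (A ** B) = mred n (mat 1)" "mred n (B ** A) = mred n (mat 1)"
    unfolding mat_eq_iff_nth using eq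
    by (simp_all add: matrix_matrix_mult_def sum_2 cong_def)
  then show "A \<in> carrier (GL2 n)"
    using A B by (auto simp: GL2_def units_of_def Units_def carrier_mat2_mod mult_mat2_mod one_mat2_mod)
qed

text \<open>An invertible coefficient gives exactly one root, a vanishing one removes
  \<open>x\<close> from the condition. Counts are kept as sums of indicators so that the entries of
  a matrix can be summed out one by one.\<close>

lemma sum_linear_residues:
  fixes a s :: int
  assumes "prime l"
  shows "(\<Sum>x\<in>{0..<int l}. of_bool (int l dvd a * x - s)) =
    (if int l dvd a then real l * of_bool (int l dvd s) else 1)"
proof (cases "int l dvd a")
  case True
  then have "int l dvd a * x - s \<longleftrightarrow> int l dvd s" for x
    by (simp add: dvd_diff_right_iff)
  with True show ?thesis by simp
next
  case False
  have l: "l > 0" using assms by (simp add: prime_gt_0_nat)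
  have "coprime a (int l)"
    using assms False by (metis coprime_commute prime_imp_coprime prime_nat_int_transfer)
  then obtain u where u: "[a * u = 1] (mod int l)"
    by (auto simp: coprime_iff_invertible_int)
  have "int l dvd a * x - s \<longleftrightarrow> x = (u * s) mod int l" if "x \<in> {0..<int l}" for x
  proof -
    have "[x = u * s] (mod int l)" if "[a * x = s] (mod int l)"
    proof -
      have "[u * (a * x) = u * s] (mod int l)" using that by (rule cong_scalar_left)
      moreover have "[(a * u) * x = 1 * x] (mod int l)" using u by (rule cong_scalar_right)
      ultimately show ?thesis by (simp add: cong_def mult_ac)
    qed
    moreover have "[a * x = s] (mod int l)" if "[x = u * s] (mod int l)"
    proof -
      have "[a * x = a * (u * s)] (mod int l)" using that by (rule cong_scalar_left)
      moreover have "[(a * u) * s = 1 * s] (mod int l)" using u by (rule cong_scalar_right)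
      ultimately show ?thesis by (simp add: cong_def mult_ac)
    qed
    moreover have "[x = u * s] (mod int l) \<longleftrightarrow> x = (u * s) mod int l"
      using that by (simp add: cong_def)
    ultimately show ?thesis
      unfolding cong_iff_dvd_diff[of "a * x", symmetric] by blast
  qed
  then have "(\<Sum>x\<in>{0..<int l}. of_bool (int l dvd a * x - s)) =
      (\<Sum>x\<in>{0..<int l}. if x = (u * s) mod int l then 1 else (0::real))"
    by (intro sum.cong) auto
  with False l show ?thesis by simp
qed

lemma sum_residues_split:
  fixes A B :: real
  assumes "l > 0"
  shows "(\<Sum>x\<in>{0..<int l}. if int l dvd x then A else B) = A + (real l - 1) * B"
proof -
  have "{0..<int l} = insert 0 {1..<int l}" using assms by auto
  moreover have "(\<Sum>x\<in>{1..<int l}. if int l dvd x then A else B) = (\<Sum>x\<in>{1..<int l}. B)"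
    by (intro sum.cong) (auto dest: zdvd_imp_le)
  ultimately show ?thesis using assms by (simp add: of_nat_diff)
qed

text \<open>For fixed \<open>b\<close> the condition is linear in \<open>c\<close>, and its
  coefficient \<open>k * b\<close> vanishes modulo \<open>l\<close> for every \<open>b\<close> or
  for \<open>b = 0\<close> only.\<close>

lemma sum_product_residues:
  fixes k s :: int
  assumes "prime l"
  shows "(\<Sum>b\<in>{0..<int l}. \<Sum>c\<in>{0..<int l}. of_bool (int l dvd k * b * c - s)) =
    (if int l dvd k then (real l)\<^sup>2 * of_bool (int l dvd s)
     else real l * of_bool (int l dvd s) + (real l - 1))"
proof (cases "int l dvd k")
  case True
  then show ?thesis
    by (simp add: sum_linear_residues[OF assms] power2_eq_square)
next
  case False
  have "int l dvd k * b \<longleftrightarrow> int l dvd b" for b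
    using False assms by (simp add: prime_dvd_mult_iff)
  with False show ?thesis
    using sum_residues_split[of l "real l * of_bool (int l dvd s)" 1] assms
    by (simp add: sum_linear_residues[OF assms] prime_gt_0_nat)
qed

lemma card_mats_eq_sum:
  "real (card {X \<in> mats n. P X}) =
     (\<Sum>a\<in>{0..<int n}. \<Sum>b\<in>{0..<int n}. \<Sum>c\<in>{0..<int n}. \<Sum>d\<in>{0..<int n}.
        of_bool (P (mat22 a b c d)))"
proof -
  have "real (card {X \<in> mats n. P X}) = (\<Sum>X\<in>mats n. of_bool (P X))"
    by (simp add: Int_def)
  then show ?thesis by (simp add: sum_mats)
qed

text \<open>A unit \<open>a\<close> determines \<open>d\<close> from any \<open>b\<close> and
  \<open>c\<close>; for \<open>a = 0\<close> the entry \<open>d\<close> is free and a condition on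
  \<open>k * b * c\<close> remains. The twist by \<open>k\<close> is the one in
  \<open>invertible_at\<close>; \<open>k = 1\<close> is the determinant.\<close>

lemma card_twisted_det:
  fixes k s :: int
  assumes "prime l"
  shows "real (card {X \<in> mats l. int l dvd X $ 1 $ 1 * X $ 2 $ 2 - (k * X $ 1 $ 2 * X $ 2 $ 1 + s)}) =
    (real l - 1) * (real l)\<^sup>2 + real l *
      (if int l dvd k then (real l)\<^sup>2 * of_bool (int l dvd s)
       else real l * of_bool (int l dvd s) + (real l - 1))"
    (is "_ = _ + real l * ?r")
proof -
  have "(\<Sum>b\<in>{0..<int l}. \<Sum>c\<in>{0..<int l}. \<Sum>d\<in>{0..<int l}.
       of_bool (int l dvd a * d - (k * b * c + s))) = (if int l dvd a then real l * ?r else (real l)\<^sup>2)"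
    for a
    using sum_product_residues[OF assms, of k "-s"]
    by (simp add: sum_linear_residues[OF assms] power2_eq_square flip: sum_distrib_left)
  then show ?thesis
    unfolding card_mats_eq_sum
    using sum_residues_split[of l "real l * ?r" "(real l)\<^sup>2"] assms by (simp add: prime_gt_0_nat)
qed

lemma card_det:
  assumes "prime l"
  shows "real (card {X \<in> mats l. int l dvd det X - d}) =
    (if int l dvd d then real l ^ 3 + (real l)\<^sup>2 - real l else real l ^ 3 - real l)"
proof -
  have "\<not> int l dvd 1" using assms prime_gt_1_nat[of l] by auto
  then show ?thesis
    using card_twisted_det[OF assms, of 1 d]
    by (simp add: det_2 diff_diff_eq algebra_simps power2_eq_square power3_eq_cube)
qed

text \<open>The local proportion for automorphisms at a prime dividing \<open>m\<close>: if
  \<open>l\<close> divides \<open>k\<close>, only the two diagonal entries have to be units;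
  otherwise it is the proportion of invertible matrices.\<close>

lemma card_not_twisted_det:
  assumes "prime l"
  shows "real (card {X \<in> mats l. \<not> int l dvd X $ 1 $ 1 * X $ 2 $ 2 - k * X $ 1 $ 2 * X $ 2 $ 1}) / real l ^ 4 =
    (if int l dvd k then (1 - 1 / real l)\<^sup>2 else (1 - 1 / (real l)\<^sup>2) * (1 - 1 / real l))"
proof -
  let ?A = "{X \<in> mats l. int l dvd X $ 1 $ 1 * X $ 2 $ 2 - k * X $ 1 $ 2 * X $ 2 $ 1}"
  have l: "real l > 0" using assms by (simp add: prime_gt_0_nat)
  have "{X \<in> mats l. \<not> int l dvd X $ 1 $ 1 * X $ 2 $ 2 - k * X $ 1 $ 2 * X $ 2 $ 1} = mats l - ?A"
    by auto
  moreover have "card ?A \<le> card (mats l)" by (intro card_mono) auto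
  ultimately have "real (card {X \<in> mats l. \<not> int l dvd X $ 1 $ 1 * X $ 2 $ 2 - k * X $ 1 $ 2 * X $ 2 $ 1})
     = real l ^ 4 - real (card ?A)"
    by (simp add: card_Diff_subset of_nat_diff card_mats)
  moreover have "real (card ?A) = (real l - 1) * (real l)\<^sup>2 +
      real l * (if int l dvd k then (real l)\<^sup>2 else 2 * real l - 1)"
    using card_twisted_det[OF assms, of k 0] by simp
  ultimately show ?thesis
    using l by (simp add: divide_simps) (simp add: algebra_simps power2_eq_square power4_eq_xxxx)
qed

lemma card_not_dvd_entry:
  assumes "prime l"
  shows "real (card {X \<in> mats l. \<not> int l dvd X $ 2 $ 2}) / real l ^ 4 = 1 - 1 / real l"
proof -
  have l: "l > 0" using assms by (simp add: prime_gt_0_nat)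
  have "(\<Sum>d\<in>{0..<int l}. of_bool (\<not> int l dvd d)) = real l - 1"
    unfolding sum_residues_split[OF l, of 0 1, simplified, symmetric] by (intro sum.cong) auto
  then show ?thesis
    using l by (simp add: card_mats_eq_sum field_simps power4_eq_xxxx)
qed

lemma card_GL2_prime:
  assumes "prime l"
  shows "real (card {X \<in> mats l. \<not> int l dvd det X}) = ((real l)\<^sup>2 - 1) * ((real l)\<^sup>2 - real l)"
proof -
  have "\<not> int l dvd 1" using assms prime_gt_1_nat[of l] by auto
  moreover have "real l > 0" using assms by (simp add: prime_gt_0_nat)
  ultimately show ?thesis
    using card_not_twisted_det[OF assms, of 1]
    by (simp add: det_2 field_simps power2_eq_square power4_eq_xxxx)
qed

text \<open>Since \<open>det (mat 1 + X) - det X\<close> is \<open>1 + trace X\<close>, the two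
  conditions fix determinant and trace. The trace determines the last entry \<open>D\<close>, and
  \<open>b * c + (a + 1) * (a + d) = 0\<close> remains, where \<open>-1\<close> and
  \<open>-d\<close> are the eigenvalues.\<close>

lemma card_det_det_add_one:
  assumes "prime l"
  shows "real (card {X \<in> mats l. int l dvd det X - d \<and> int l dvd det (mat 1 + X)}) =
    (if int l dvd d - 1 then (real l)\<^sup>2 else (real l)\<^sup>2 + real l)"
proof -
  let ?I = "{0..<int l}"
  have l: "l > 0" using assms by (simp add: prime_gt_0_nat)
  have unit: "\<not> int l dvd 1" using assms prime_gt_1_nat[of l] by auto
  have inner: "(\<Sum>D\<in>?I. of_bool (int l dvd det (mat22 a b c D) - d \<and> int l dvd det (mat 1 + mat22 a b c D)))
     = (of_bool (int l dvd 1 * b * c - - ((a + 1) * (a + d))) :: real)" for a b c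
  proof -
    let ?s = "- 1 - a - d"
    have "(int l dvd det (mat22 a b c D) - d \<and> int l dvd det (mat 1 + mat22 a b c D)) \<longleftrightarrow>
       int l dvd 1 * D - ?s \<and> int l dvd b * c + (a + 1) * (a + d)" (is "?p \<and> ?q \<longleftrightarrow> ?r \<and> ?t") for D
    proof -
      have 1: "det (mat 1 + mat22 a b c D) = (det (mat22 a b c D) - d) + (1 * D - ?s)"
        by (simp add: det_2 mat_def algebra_simps)
      have 2: "det (mat22 a b c D) - d = a * (1 * D - ?s) - (b * c + (a + 1) * (a + d))"
        by (simp add: det_2 algebra_simps)
      show ?thesis
        unfolding 1 using 2 by (metis dvd_add_right_iff dvd_diff_right_iff dvd_mult)
    qed
    then have "(\<Sum>D\<in>?I. of_bool (int l dvd det (mat22 a b c D) - d \<and> int l dvd det (mat 1 + mat22 a b c D)))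
       = (\<Sum>D\<in>?I. of_bool (int l dvd 1 * D - ?s)) * (of_bool (int l dvd b * c + (a + 1) * (a + d)) :: real)"
      by (simp add: sum_distrib_right of_bool_conj)
    also have "(\<Sum>D\<in>?I. of_bool (int l dvd 1 * D - ?s)) = (1::real)"
      unfolding sum_linear_residues[OF assms] using unit by simp
    finally show ?thesis by simp
  qed
  \<comment> \<open>Inclusion-exclusion for the roots \<open>-1\<close> and \<open>-d\<close>, which
    coincide exactly when \<open>l\<close> divides \<open>d - 1\<close>.\<close>
  have "of_bool (int l dvd (a + 1) * (a + d)) = of_bool (int l dvd a + 1) + of_bool (int l dvd a + d)
      - of_bool (int l dvd d - 1) * (of_bool (int l dvd a + 1) :: real)" for a
  proof -
    have "int l dvd (a + 1) * (a + d) \<longleftrightarrow> int l dvd a + 1 \<or> int l dvd a + d"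
      using assms by (simp add: prime_dvd_mult_iff)
    moreover have "a + d = (a + 1) + (d - 1)" by simp
    then have "int l dvd a + 1 \<Longrightarrow> int l dvd a + d \<longleftrightarrow> int l dvd d - 1"
      by (metis dvd_add_right_iff)
    ultimately show ?thesis
      by (cases "int l dvd a + 1") simp_all
  qed
  then have "(\<Sum>a\<in>?I. of_bool (int l dvd (a + 1) * (a + d))) =
      (\<Sum>a\<in>?I. of_bool (int l dvd a + 1)) + (\<Sum>a\<in>?I. of_bool (int l dvd a + d))
      - of_bool (int l dvd d - 1) * (\<Sum>a\<in>?I. of_bool (int l dvd a + 1) :: real)"
    unfolding sum_distrib_left sum.distrib[symmetric] sum_subtractf[symmetric] by (intro sum.cong) simp_all
  moreover have "(\<Sum>a\<in>?I. of_bool (int l dvd a + t)) = (1::real)" for t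
  proof -
    have "(\<Sum>a\<in>?I. of_bool (int l dvd 1 * a - - t)) = (1::real)"
      unfolding sum_linear_residues[OF assms] using unit by simp
    then show ?thesis unfolding mult_1 minus_minus diff_minus_eq_add .
  qed
  ultimately have roots: "(\<Sum>a\<in>?I. of_bool (int l dvd (a + 1) * (a + d))) = 2 - (of_bool (int l dvd d - 1) :: real)"
    by simp
  have "real (card {X \<in> mats l. int l dvd det X - d \<and> int l dvd det (mat 1 + X)})
     = (\<Sum>a\<in>?I. real l * of_bool (int l dvd (a + 1) * (a + d)) + (real l - 1))"
    unfolding card_mats_eq_sum inner sum_product_residues[OF assms] dvd_minus_iff using unit by simp
  also have "\<dots> = real l * (2 - of_bool (int l dvd d - 1)) + real l * (real l - 1)"
    unfolding sum.distrib sum_distrib_left[symmetric] roots by simp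
  finally show ?thesis by (auto simp: algebra_simps power2_eq_square)
qed

section \<open>Lifting solutions to prime powers\<close>

text \<open>The last variable with a unit coefficient is determined by the other three.\<close>

lemma card_linear_form:
  fixes c1 c2 c3 c4 s :: int
  assumes l: "prime l"
    and nz: "\<not> (int l dvd c1 \<and> int l dvd c2 \<and> int l dvd c3 \<and> int l dvd c4)"
  shows "card {X \<in> mats l. int l dvd c1 * X $ 1 $ 1 + c2 * X $ 1 $ 2 + c3 * X $ 2 $ 1 + c4 * X $ 2 $ 2 - s}
    = l ^ 3"
proof -
  let ?I = "{0..<int l}"
  \<comment> \<open>\<open>t\<close> collects the terms in the variables not yet summed. A vanishing
    coefficient yields a factor \<open>l\<close> and a condition of the same shape, so
    \<open>S1\<close>, \<open>S2\<close>, \<open>S3\<close> can be chained.\<close>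
  have S1: "(\<Sum>d\<in>?I. of_bool (int l dvd t + c4 * d - s)) =
      (if int l dvd c4 then real l * of_bool (int l dvd t - s) else 1)" for t s
    using sum_linear_residues[OF l, of c4 "s - t"]
    by (simp only: dvd_diff_commute[of _ s t]) (simp add: algebra_simps)
  have S2: "(\<Sum>c\<in>?I. of_bool (int l dvd t + c3 * c - s)) =
      (if int l dvd c3 then real l * of_bool (int l dvd t - s) else 1)" for t s
    using sum_linear_residues[OF l, of c3 "s - t"]
    by (simp only: dvd_diff_commute[of _ s t]) (simp add: algebra_simps)
  have S3: "(\<Sum>b\<in>?I. of_bool (int l dvd t + c2 * b - s)) =
      (if int l dvd c2 then real l * of_bool (int l dvd t - s) else 1)" for t s
    using sum_linear_residues[OF l, of c2 "s - t"]
    by (simp only: dvd_diff_commute[of _ s t]) (simp add: algebra_simps)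
  have "real (card {X \<in> mats l. int l dvd c1 * X $ 1 $ 1 + c2 * X $ 1 $ 2 + c3 * X $ 2 $ 1 + c4 * X $ 2 $ 2 - s})
    = real l ^ 3"
  proof -
    consider "\<not> int l dvd c4" | "int l dvd c4" "\<not> int l dvd c3"
      | "int l dvd c4" "int l dvd c3" "\<not> int l dvd c2"
      | "int l dvd c4" "int l dvd c3" "int l dvd c2" "\<not> int l dvd c1"
      using nz by blast
    then show ?thesis
    proof cases
      case 1
      then show ?thesis
        unfolding card_mats_eq_sum mat22_nth S1 by (simp add: power3_eq_cube)
    next
      case 2
      then show ?thesis
        unfolding card_mats_eq_sum mat22_nth S1
        by (simp only: if_True sum_distrib_left[symmetric] S2) (simp add: power3_eq_cube)
    next
      case 3
      then show ?thesis
        unfolding card_mats_eq_sum mat22_nth S1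
        by (simp only: if_True sum_distrib_left[symmetric] S2 S3) (simp add: power3_eq_cube)
    next
      case 4
      then show ?thesis
        unfolding card_mats_eq_sum mat22_nth S1
        by (simp only: if_True sum_distrib_left[symmetric] S2 S3 sum_linear_residues[OF l])
          (simp add: power3_eq_cube)
    qed
  qed
  then show ?thesis by (simp flip: of_nat_power)
qed

text \<open>Modulo \<open>l ^ (n + 1)\<close>, \<open>det (A + l ^ n X)\<close> is \<open>det A + l ^ n L X\<close> with \<open>L\<close> the linear form whose coefficients are the cofactors of \<open>A\<close>; it is non-zero modulo \<open>l\<close> because \<open>A\<close> is.\<close>

lemma card_hensel_step:
  assumes l: "prime l" and n: "n > 0"
  shows "card {X \<in> mats (l ^ Suc n). int (l ^ Suc n) dvd det X - d \<and> mred l X \<noteq> 0 \<and> P (mred l X)}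
    = l ^ 3 * card {X \<in> mats (l ^ n). int (l ^ n) dvd det X - d \<and> mred l X \<noteq> 0 \<and> P (mred l X)}"
proof -
  let ?q = "int (l ^ n)"
  have q: "l ^ n > 0" "?q \<noteq> 0" using l by (simp_all add: prime_gt_0_nat)
  let ?Q = "\<lambda>X. int (l ^ Suc n) dvd det X - d \<and> mred l X \<noteq> 0 \<and> P (mred l X)"
  let ?R = "\<lambda>X. ?q dvd det X - d \<and> mred l X \<noteq> 0 \<and> P (mred l X)"
  have lq: "int l dvd ?q" using n by (simp add: dvd_power)
  have fibre: "card {X \<in> mats l. ?Q (mlift (l ^ n) A X)} = (if ?R A then l ^ 3 else 0)"
    for A
  proof -
    define L where "L X = A $ 2 $ 2 * X $ 1 $ 1 + (- A $ 2 $ 1) * X $ 1 $ 2 + (- A $ 1 $ 2) * X $ 2 $ 1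
      + A $ 1 $ 1 * X $ 2 $ 2" for X :: "int^2^2"
    \<comment> \<open>Exact expansion. As \<open>n > 0\<close>, \<open>l\<close> divides
      \<open>?q\<close>, so the quadratic term drops out of the condition on \<open>X\<close> modulo
      \<open>l\<close>.\<close>
    have det: "det (mlift (l ^ n) A X) - d = (det A - d) + ?q * (L X + ?q * det X)" for X
      by (simp add: det_2 L_def algebra_simps)
    have red: "mred l (mlift (l ^ n) A X) = mred l A" for X
      using lq unfolding mat_eq_iff_nth by (auto simp: mod_eq_dvd_iff)
    show ?thesis
    proof (cases "?R A")
      case True
      then obtain r where r: "det A - d = ?q * r" by blast
      have "?Q (mlift (l ^ n) A X) \<longleftrightarrow> int l dvd L X - - r" for X
      proof -
        have "det (mlift (l ^ n) A X) - d = ?q * (L X - - r + ?q * det X)"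
          unfolding det r by (simp add: algebra_simps)
        moreover have "int (l ^ Suc n) = ?q * int l" by simp
        ultimately have "int (l ^ Suc n) dvd det (mlift (l ^ n) A X) - d \<longleftrightarrow> int l dvd L X - - r + ?q * det X"
          using q by (simp only: dvd_mult_cancel_left) simp
        also have "\<dots> \<longleftrightarrow> int l dvd L X - - r"
          using lq by (intro dvd_add_left_iff) (rule dvd_mult2)
        finally show ?thesis using True by (simp only: red) simp
      qed
      moreover have "\<not> (int l dvd A $ 2 $ 2 \<and> int l dvd - A $ 2 $ 1 \<and> int l dvd - A $ 1 $ 2 \<and> int l dvd A $ 1 $ 1)"
      proof
        assume *: "int l dvd A $ 2 $ 2 \<and> int l dvd - A $ 2 $ 1 \<and> int l dvd - A $ 1 $ 2 \<and> int l dvd A $ 1 $ 1"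
        have "mred l A = 0"
          using * by (simp add: mat_eq_iff_nth forall_2)
        then show False using True by simp
      qed
      ultimately show ?thesis
        using card_linear_form[OF l, of "A $ 2 $ 2" "- A $ 2 $ 1" "- A $ 1 $ 2" "A $ 1 $ 1" "- r"] True
        unfolding L_def by simp
    next
      case False
      \<comment> \<open>Solutions reduce to solutions one level below, so the fibre over a
        non-solution is empty.\<close>
      have "\<not> ?Q (mlift (l ^ n) A X)" for X
      proof
        assume Q: "?Q (mlift (l ^ n) A X)"
        have "?q dvd int (l ^ Suc n)" by simp
        then have "?q dvd det (mlift (l ^ n) A X) - d" using Q dvd_trans by blast
        then have "?q dvd det A - d" unfolding det by (simp add: dvd_add_left_iff)
        then show False using Q False by (simp only: red) simp
      qed
      then have "{X \<in> mats l. ?Q (mlift (l ^ n) A X)} = {}" by blast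
      then show ?thesis using False by (simp only: if_False card.empty)
    qed
  qed
  have "card {X \<in> mats (l ^ n * l). ?Q X}
      = card {p \<in> mats (l ^ n) \<times> mats l. ?Q (case p of (A, X) \<Rightarrow> mlift (l ^ n) A X)}"
    by (rule card_bij_Collect[OF bij_mlift[OF q(1)]])
  also have "{p \<in> mats (l ^ n) \<times> mats l. ?Q (case p of (A, X) \<Rightarrow> mlift (l ^ n) A X)}
      = Sigma (mats (l ^ n)) (\<lambda>A. {X \<in> mats l. ?Q (mlift (l ^ n) A X)})"
    by auto
  also have "card \<dots> = (\<Sum>A\<in>mats (l ^ n). if ?R A then l ^ 3 else 0)"
    unfolding fibre[symmetric] by (rule card_SigmaI) auto
  also have "\<dots> = l ^ 3 * card {A \<in> mats (l ^ n). ?R A}"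
    by (simp add: sum.If_cases Int_def)
  finally show ?thesis by (simp only: power_Suc mult.commute[of l])
qed

text \<open>The lifting step is applied \<open>f\<close> times, from level \<open>l\<close> upwards.
  \<open>P\<close> later carries the invertibility of \<open>\<sigma>\<close>, a condition on
  \<open>X\<close> modulo \<open>l\<close> only.\<close>

lemma card_hensel:
  assumes "prime l"
  shows "card {X \<in> mats (l ^ Suc f). int (l ^ Suc f) dvd det X - d \<and> mred l X \<noteq> 0 \<and> P (mred l X)}
    = l ^ (3 * f) * card {X \<in> mats l. int l dvd det X - d \<and> X \<noteq> 0 \<and> P X}"
proof (induction f)
  case 0
  have "{X \<in> mats l. int l dvd det X - d \<and> mred l X \<noteq> 0 \<and> P (mred l X)}
      = {X \<in> mats l. int l dvd det X - d \<and> X \<noteq> 0 \<and> P X}"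
    by (auto simp: mred_ident)
  then show ?case by simp
next
  case (Suc f)
  then show ?case
    unfolding card_hensel_step[OF assms, of "Suc f", simplified zero_less_Suc, OF TrueI]
    by (simp add: power_add)
qed

text \<open>Multiples of \<open>c\<close> modulo \<open>c * M\<close> are \<open>c * T\<close> with
  \<open>T\<close> unique modulo \<open>M\<close>.\<close>

lemma bij_one_plus:
  assumes "c > 0" "M > 0"
  shows "bij_betw (\<lambda>T. mred (c * M) (mlift c (mat 1) T)) (mats M) {S \<in> mats (c * M). mat_cong S (mat 1) c}"
  unfolding bij_betw_def
proof
  show "inj_on (\<lambda>T. mred (c * M) (mlift c (mat 1) T)) (mats M)"
  proof (rule inj_onI)
    fix T U assume TU: "T \<in> mats M" "U \<in> mats M"
      and eq: "mred (c * M) (mlift c (mat 1) T) = mred (c * M) (mlift c (mat 1) U)"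
    have "T $ i $ j = U $ i $ j" for i j
    proof -
      have "int (c * M) dvd int c * T $ i $ j - int c * U $ i $ j"
        using eq by (simp add: mat_eq_iff_nth mod_eq_dvd_iff)
      then have "int M dvd T $ i $ j - U $ i $ j"
        using assms by (simp flip: right_diff_distrib)
      then have "T $ i $ j mod int M = U $ i $ j mod int M"
        by (simp add: mod_eq_dvd_iff)
      then show ?thesis using TU by (simp add: mats_def)
    qed
    then show "T = U" by (simp add: mat_eq_iff_nth)
  qed
  show "(\<lambda>T. mred (c * M) (mlift c (mat 1) T)) ` mats M = {S \<in> mats (c * M). mat_cong S (mat 1) c}"
  proof (intro equalityI subsetI)
    fix S assume "S \<in> (\<lambda>T. mred (c * M) (mlift c (mat 1) T)) ` mats M"
    then obtain T where "S = mred (c * M) (mlift c (mat 1) T)" by blast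
    then show "S \<in> {S \<in> mats (c * M). mat_cong S (mat 1) c}"
      using assms by (auto simp: mat_cong_def cong_def mod_mod_cancel simp del: of_nat_mult)
  next
    fix S assume S: "S \<in> {S \<in> mats (c * M). mat_cong S (mat 1) c}"
    \<comment> \<open>The quotient of \<open>S - mat 1\<close> by \<open>c\<close>, exact because
      \<open>S\<close> is congruent to the identity modulo \<open>c\<close>.\<close>
    define T where "T = mred M (\<chi> i j. (S $ i $ j - (mat 1 :: int^2^2) $ i $ j) div int c)"
    have "int c * T $ i $ j = (S $ i $ j - (mat 1 :: int^2^2) $ i $ j) mod int (c * M)" for i j
    proof -
      have "int c * T $ i $ j = (int c * ((S $ i $ j - (mat 1 :: int^2^2) $ i $ j) div int c)) mod int (c * M)"
        unfolding T_def mred_nth vec_lambda_beta of_nat_mult by (rule mult_mod_right)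
      also have "int c * ((S $ i $ j - (mat 1 :: int^2^2) $ i $ j) div int c) = S $ i $ j - (mat 1 :: int^2^2) $ i $ j"
        using S by (intro dvd_mult_div_cancel) (auto simp: mat_cong_def cong_iff_dvd_diff)
      finally show ?thesis .
    qed
    then have "S = mred (c * M) (mlift c (mat 1) T)"
      using S by (simp add: mat_eq_iff_nth mats_def mod_add_right_eq del: of_nat_mult)
    moreover have "T \<in> mats M" using assms by (simp add: T_def)
    ultimately show "S \<in> (\<lambda>T. mred (c * M) (mlift c (mat 1) T)) ` mats M" by blast
  qed
qed

section \<open>Reduction of the density count to a count modulo \<open>l\<close>\<close>

lemma coprime_int_prime_power:
  assumes "prime l" "n > 0"
  shows "coprime x (int (l ^ n)) \<longleftrightarrow> \<not> int l dvd x"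
proof -
  have "coprime x (int l) \<longleftrightarrow> \<not> int l dvd x"
    using assms(1) by (metis coprime_commute coprime_absorb_left prime_imp_coprime prime_nat_int_transfer not_prime_unit)
  then show ?thesis using assms(2) by simp
qed

lemma dvd_det_mred: "int l dvd int n \<Longrightarrow> int l dvd det (mred n A) \<longleftrightarrow> int l dvd det A"
  using cong_dvd_iff[OF cong_dvd_modulus[OF det_cong_mred[of n A], of "int l"]] .

text \<open>Here \<open>N\<close> is the cofactor of \<open>l ^ (2 * a)\<close> in the group order.
  Writing \<open>\<sigma>\<close> as \<open>1 + c T\<close>, the matrix \<open>T\<close> lives
  modulo \<open>q * c\<close>, but every condition depends on \<open>T\<close> modulo
  \<open>q\<close> only. This gives a factor \<open>c ^ 4\<close>, and lifting from \<open>l\<close>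
  to \<open>q\<close> gives \<open>l ^ (3 * f)\<close>.\<close>

lemma card_GL2_density_set:
  assumes l: "prime l" and e: "e = 2 * a + Suc f"
  shows "card {\<sigma> \<in> carrier (GL2 (l ^ e)).
        [det \<sigma> + 1 - trace \<sigma> = int (l ^ (2 * a) * N)] (mod int (l ^ e)) \<and>
        mat_cong \<sigma> (mat 1) (l ^ a) \<and> \<not> mat_cong \<sigma> (mat 1) (l ^ (a + 1))}
    = l ^ (4 * a + 3 * f) * card {X \<in> mats l. int l dvd det X - int N \<and> X \<noteq> 0 \<and>
        \<not> int l dvd det (mlift (l ^ a) (mat 1) X)}"
proof -
  define c where "c = l ^ a"
  \<comment> \<open>The modulus \<open>l ^ (e - 2 * a)\<close> that is left once
    \<open>c * c\<close> is cancelled from the determinant congruence.\<close>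
  define q where "q = l ^ Suc f"
  have pos: "l > 0" "c > 0" "q > 0" using l by (simp_all add: prime_gt_0_nat c_def q_def)
  have le: "l ^ e = c * (q * c)" "l ^ (2 * a) = c * c" "l ^ (a + 1) = c * l"
    by (simp_all add: e c_def q_def power_add mult_2)
  have lq: "l dvd q" "l dvd q * c" "l dvd l ^ e" unfolding e by (simp_all add: q_def)
  let ?A = "\<lambda>T. mlift c (mat 1) T"
  let ?good = "\<lambda>S. coprime (det S) (int (l ^ e)) \<and> [det S + 1 - trace S = int (l ^ (2 * a) * N)] (mod int (l ^ e))
     \<and> \<not> mat_cong S (mat 1) (l ^ (a + 1))"
  let ?P = "\<lambda>X. \<not> int l dvd det (?A X)"
  let ?H = "\<lambda>X. int q dvd det X - int N \<and> mred l X \<noteq> 0 \<and> ?P (mred l X)"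
  have good: "?good (mred (l ^ e) (?A T)) \<longleftrightarrow> ?H (mred q T)" for T
  proof -
    have "coprime (det (mred (l ^ e) (?A T))) (int (l ^ e)) \<longleftrightarrow> ?P T"
      using l lq(3) e by (subst coprime_int_prime_power) (simp_all add: dvd_det_mred del: of_nat_power)
    \<comment> \<open>Invertibility is decided modulo \<open>l\<close>, hence by \<open>T\<close>
      modulo \<open>l\<close>.\<close>
    also have "\<dots> \<longleftrightarrow> ?P (mred l T)"
    proof -
      have "mred l (?A T) = mred l (?A (mred l T))"
        by (simp add: mat_eq_iff_nth) (metis mod_add_right_eq mod_mult_right_eq)
      then show ?thesis by (metis dvd_det_mred dvd_refl)
    qed
    finally have 1: "coprime (det (mred (l ^ e) (?A T))) (int (l ^ e)) \<longleftrightarrow> ?P (mred l (mred q T))"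
      using lq by (simp add: mred_mred)
    have "[det (mred (l ^ e) (?A T)) + 1 - trace (mred (l ^ e) (?A T)) = det (?A T) + 1 - trace (?A T)]
        (mod int (l ^ e))"
      by (intro cong_diff cong_add det_cong_mred cong_refl)
        (simp add: trace_def sum_2 cong_def mod_add_eq)
    moreover have "det (?A T) + 1 - trace (?A T) = int (c * c) * det T"
      by (simp add: det_2 trace_def sum_2 mat_def algebra_simps)
    ultimately have "[det (mred (l ^ e) (?A T)) + 1 - trace (mred (l ^ e) (?A T)) = int (l ^ (2 * a) * N)]
        (mod int (l ^ e)) \<longleftrightarrow> [int (c * c) * det T = int (l ^ (2 * a) * N)] (mod int (l ^ e))"
      by (simp only: cong_def)
    also have "\<dots> \<longleftrightarrow> [int (c * c) * det T = int (c * c * N)] (mod int (c * (q * c)))"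
      unfolding le ..
    also have "\<dots> \<longleftrightarrow> int (c * c) * int q dvd int (c * c) * (det T - int N)"
      by (simp add: cong_iff_dvd_diff algebra_simps)
    also have "\<dots> \<longleftrightarrow> int q dvd det T - int N"
      using pos by simp
    also have "\<dots> \<longleftrightarrow> int q dvd det (mred q T) - int N"
      using det_cong_mred[of q T] unfolding cong_iff_dvd_diff[symmetric] by (simp only: cong_def)
    finally have 2: "[det (mred (l ^ e) (?A T)) + 1 - trace (mred (l ^ e) (?A T)) = int (l ^ (2 * a) * N)]
        (mod int (l ^ e)) \<longleftrightarrow> int q dvd det (mred q T) - int N" .
    have "[mred (l ^ e) (?A T) $ i $ j = (mat 1 :: int^2^2) $ i $ j] (mod int (c * l)) \<longleftrightarrow>
        int l dvd T $ i $ j" for i j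
    proof -
      have "int (c * l) dvd int (l ^ e)" using lq unfolding le by simp
      then have "[mred (l ^ e) (?A T) $ i $ j = ?A T $ i $ j] (mod int (c * l))"
        by (simp add: cong_def mod_mod_cancel del: of_nat_mult of_nat_power)
      then have "[mred (l ^ e) (?A T) $ i $ j = (mat 1 :: int^2^2) $ i $ j] (mod int (c * l)) \<longleftrightarrow>
          [?A T $ i $ j = (mat 1 :: int^2^2) $ i $ j] (mod int (c * l))"
        by (simp only: cong_def)
      also have "\<dots> \<longleftrightarrow> int l dvd T $ i $ j"
        using pos by (simp add: cong_iff_dvd_diff)
      finally show ?thesis .
    qed
    then have "mat_cong (mred (l ^ e) (?A T)) (mat 1) (l ^ (a + 1)) \<longleftrightarrow> mred l T = 0"
      unfolding mat_cong_def le by (simp add: mat_eq_iff_nth dvd_eq_mod_eq_0)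
    then have 3: "mat_cong (mred (l ^ e) (?A T)) (mat 1) (l ^ (a + 1)) \<longleftrightarrow> mred l (mred q T) = 0"
      using lq by (simp add: mred_mred)
    show ?thesis using 1 2 3 by blast
  qed
  have "{\<sigma> \<in> carrier (GL2 (l ^ e)).
        [det \<sigma> + 1 - trace \<sigma> = int (l ^ (2 * a) * N)] (mod int (l ^ e)) \<and>
        mat_cong \<sigma> (mat 1) (l ^ a) \<and> \<not> mat_cong \<sigma> (mat 1) (l ^ (a + 1))}
     = {S \<in> {S \<in> mats (c * (q * c)). mat_cong S (mat 1) c}. ?good S}" (is "?S = _")
    using pos by (auto simp: carrier_GL2 c_def[symmetric] le simp del: of_nat_mult of_nat_power power_Suc power_add)
  then have "card ?S = card {S \<in> {S \<in> mats (c * (q * c)). mat_cong S (mat 1) c}. ?good S}"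
    by (simp only:)
  moreover have "card {S \<in> {S \<in> mats (c * (q * c)). mat_cong S (mat 1) c}. ?good S}
      = card {T \<in> mats (q * c). ?good (mred (c * (q * c)) (?A T))}"
    using pos by (intro card_bij_Collect bij_one_plus) simp_all
  moreover have "{T \<in> mats (q * c). ?good (mred (c * (q * c)) (?A T))} = {T \<in> mats (q * c). ?H (mred q T)}"
    unfolding le(1)[symmetric] by (rule Collect_cong, rule conj_cong[OF refl], rule good)
  moreover have "card {T \<in> mats (q * c). ?H (mred q T)} = c ^ 4 * card {T \<in> mats q. ?H T}"
    by (rule card_mred[OF pos(3), of c ?H])
  moreover have "card {T \<in> mats q. ?H T} = l ^ (3 * f) * card {X \<in> mats l. int l dvd det X - int N \<and> X \<noteq> 0 \<and> ?P X}"
    unfolding q_def by (rule card_hensel[OF l, of f "int N" ?P])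
  ultimately have "card ?S = c ^ 4 * (l ^ (3 * f) * card {X \<in> mats l. int l dvd det X - int N \<and> X \<noteq> 0 \<and> ?P X})"
    by (simp only:)
  also have "\<dots> = l ^ (4 * a + 3 * f) * card {X \<in> mats l. int l dvd det X - int N \<and> X \<noteq> 0 \<and> ?P X}"
    by (simp add: c_def power_add mult.commute flip: power_mult)
  finally show ?thesis unfolding c_def .
qed

text \<open>Invertibility is tested modulo \<open>l\<close>, and every matrix modulo
  \<open>l\<close> has \<open>l ^ (4 * n)\<close> lifts.\<close>

lemma order_GL2_prime_power:
  assumes l: "prime l"
  shows "real (order (GL2 (l ^ Suc n))) = real l ^ (4 * n) * (((real l)\<^sup>2 - 1) * ((real l)\<^sup>2 - real l))"
proof -
  have pos: "l > 0" using l by (simp add: prime_gt_0_nat)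
  have "carrier (GL2 (l ^ Suc n)) = {X \<in> mats (l * l ^ n). \<not> int l dvd det (mred l X)}"
    using pos l by (simp add: carrier_GL2 coprime_int_prime_power dvd_det_mred del: of_nat_power power_Suc)
      simp
  then have "order (GL2 (l ^ Suc n)) = (l ^ n) ^ 4 * card {X \<in> mats l. \<not> int l dvd det X}"
    unfolding order_def by (simp only: card_mred[OF pos, of "l ^ n" "\<lambda>X. \<not> int l dvd det X"])
  then show ?thesis
    using card_GL2_prime[OF l] by (simp add: mult.commute flip: power_mult)
qed

section \<open>The local densities\<close>

text \<open>For \<open>l\<close> dividing neither \<open>m\<close> nor \<open>k\<close> this is the
  factor at \<open>l\<close> of the infinite product in \<open>K_const\<close>. At the other primes
  it is the quotient of a factor of \<open>K_const\<close> by a power of \<open>l\<close> and a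
  factor of the automorphism count.\<close>

definition local_factor :: "nat \<Rightarrow> nat \<Rightarrow> nat \<Rightarrow> real" where
  "local_factor m k l =
     (if l dvd m
      then (if l dvd k then (real l + 1) / (real l - 1) else real l / (real l - 1)) / real l ^ (2 * multiplicity l m)
      else if l dvd k then ((real l)\<^sup>2 - real l - 1) / (real l - 1)\<^sup>2
      else 1 - ((of_int (kronecker_prime (int (m\<^sup>2 * k) - 1) l))\<^sup>2 * real l + 1)
               / ((real l - 1)\<^sup>2 * (real l + 1)))"

lemma det_0_22 [simp]: "det (0 :: int^2^2) = 0"
  by (simp add: det_2)

text \<open>The zero matrix is among the solutions exactly when \<open>l\<close> divides
  \<open>d\<close>.\<close>

lemma card_det_nonzero:
  assumes l: "prime l"
  shows "real (card {X \<in> mats l. int l dvd det X - d \<and> X \<noteq> 0}) =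
    (if int l dvd d then real l ^ 3 + (real l)\<^sup>2 - real l - 1 else real l ^ 3 - real l)"
proof -
  let ?A = "{X \<in> mats l. int l dvd det X - d}"
  have zero: "0 \<in> ?A \<longleftrightarrow> int l dvd d"
    using l by (simp add: mats_def prime_gt_0_nat)
  have eq: "{X \<in> mats l. int l dvd det X - d \<and> X \<noteq> 0} = ?A - {0}" by auto
  show ?thesis
  proof (cases "int l dvd d")
    case True
    then have "card ?A > 0" using zero by (intro card_gt_0_iff[THEN iffD2]) auto
    then show ?thesis
      unfolding eq using card_det[OF l, of d] True zero by (simp add: of_nat_diff)
  next
    case False
    then show ?thesis
      unfolding eq using card_det[OF l, of d] zero by simp
  qed
qed

text \<open>Serves primes not dividing \<open>m\<close>, where \<open>\<sigma>\<close> is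
  \<open>mat 1 + X\<close> and its invertibility is a real restriction. The singular solutions
  \<open>?B\<close> are removed; \<open>X = 0\<close> is not among them because \<open>mat 1\<close>
  is invertible.\<close>

lemma card_det_nonzero_invertible:
  assumes l: "prime l"
  shows "real (card {X \<in> mats l. int l dvd det X - d \<and> X \<noteq> 0 \<and> \<not> int l dvd det (mat 1 + X)}) =
    (if int l dvd d then (real l + 1) * ((real l)\<^sup>2 - real l - 1)
     else if int l dvd d - 1 then real l * ((real l)\<^sup>2 - real l - 1)
     else real l * ((real l)\<^sup>2 - real l - 2))"
proof -
  let ?A = "{X \<in> mats l. int l dvd det X - d \<and> X \<noteq> 0}"
  let ?B = "{X \<in> mats l. int l dvd det X - d \<and> int l dvd det (mat 1 + X)}"
  have unit: "\<not> int l dvd 1" using assms prime_gt_1_nat[of l] by auto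
  have sub: "?B \<subseteq> ?A" using unit by (auto simp: det_I)
  have "{X \<in> mats l. int l dvd det X - d \<and> X \<noteq> 0 \<and> \<not> int l dvd det (mat 1 + X)} = ?A - ?B"
    by auto
  moreover have "card ?B \<le> card ?A" using sub by (intro card_mono) auto
  ultimately have "real (card {X \<in> mats l. int l dvd det X - d \<and> X \<noteq> 0 \<and> \<not> int l dvd det (mat 1 + X)})
      = real (card ?A) - real (card ?B)"
    using sub by (simp add: card_Diff_subset of_nat_diff)
  moreover have "\<not> (int l dvd d \<and> int l dvd d - 1)"
    using unit by (metis diff_diff_eq2 add_diff_cancel_left' dvd_diff)
  ultimately show ?thesis
    unfolding card_det_nonzero[OF l] card_det_det_add_one[OF l]
    by (auto simp: algebra_simps power2_eq_square power3_eq_cube)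
qed

lemma multiplicity_square_mult:
  assumes "prime l" "m > 0" "k > (0::nat)"
  shows "multiplicity l (m\<^sup>2 * k) = 2 * multiplicity l m + multiplicity l k"
  using assms by (simp add: prime_elem_multiplicity_mult_distrib prime_elem_multiplicity_power_distrib)

lemma matrix_density_eq_local_factor:
  assumes l: "prime l" and mk: "m > 0" "k > 0"
    and e: "e > multiplicity l (order (rank2_group m k))"
  shows "matrix_density m k l e = local_factor m k l"
proof -
  define a where "a = multiplicity l m"
  have "e \<ge> 2 * a + 1"
    using e l mk by (simp add: order_rank2_group multiplicity_square_mult a_def)
  then obtain f where f: "e = 2 * a + Suc f"
    using le_Suc_ex[of "2 * a + 1" e] by auto
  obtain m' where m': "m = l ^ a * m'" "\<not> l dvd m'"
    using multiplicity_decompose'[of m l] l mk unfolding a_def by (metis neq0_conv not_prime_unit)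
  define N where "N = m'\<^sup>2 * k"
  have order: "order (rank2_group m k) = l ^ (2 * a) * N"
    using mk by (simp add: order_rank2_group N_def m'(1) power_mult_distrib mult_ac flip: power_mult)
  have lN: "l dvd N \<longleftrightarrow> l dvd k"
    using l m'(2) by (simp add: N_def prime_dvd_mult_iff prime_dvd_power_iff)
  have lm: "l dvd m \<longleftrightarrow> a > 0"
    using l mk by (simp add: a_def prime_multiplicity_gt_zero_iff)
  have x: "real l > 1" using prime_gt_1_nat[OF l] by simp
  define h where "h = real (card {X \<in> mats l. int l dvd det X - int N \<and> X \<noteq> 0 \<and>
        \<not> int l dvd det (mlift (l ^ a) (mat 1) X)})"
  define G where "G = ((real l)\<^sup>2 - 1) * ((real l)\<^sup>2 - real l)"
  \<comment> \<open>With \<open>e = 2 * a + Suc f\<close> all powers of \<open>l\<close> containing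
    \<open>f\<close> cancel, so the density no longer depends on \<open>e\<close>.\<close>
  have dens: "matrix_density m k l e = real l * h / (real l ^ (2 * a) * G)"
  proof -
    have "matrix_density m k l e = real l ^ e * (real l ^ (4 * a + 3 * f) * h) / (real l ^ (4 * (2 * a + f)) * G)"
      unfolding matrix_density_def order a_def[symmetric] card_GL2_density_set[OF l f]
      using order_GL2_prime_power[OF l, of "2 * a + f"] by (simp add: f h_def G_def)
    also have "\<dots> = real l * h / (real l ^ (2 * a) * G)"
    proof -
      have "real l ^ e * real l ^ (4 * a + 3 * f) * real l ^ (2 * a) = real l * real l ^ (4 * (2 * a + f))"
        unfolding power_add[symmetric] power_Suc[symmetric] by (simp add: f)
      from arg_cong[OF this, of "\<lambda>t. t * (h * G)"]
      have "real l ^ e * (real l ^ (4 * a + 3 * f) * h) * (real l ^ (2 * a) * G)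
         = real l * h * (real l ^ (4 * (2 * a + f)) * G)"
        by (simp only: mult_ac)
      moreover have "G > 0"
        unfolding G_def using x by (intro mult_pos_pos) (simp_all add: power2_eq_square less_1_mult)
      ultimately show ?thesis using x by (simp add: frac_eq_eq)
    qed
    finally show ?thesis .
  qed
  show ?thesis
  proof (cases "a > 0")
    case True
    \<comment> \<open>For \<open>l\<close> dividing \<open>m\<close>, \<open>\<sigma>\<close> is the
      identity modulo \<open>l\<close>, hence invertible; \<open>h\<close> then counts non-zero
      \<open>X\<close> by determinant alone.\<close>
    then have "int l dvd int (l ^ a)" by (simp add: dvd_power)
    then have "mred l (mlift (l ^ a) (mat 1) X) = mred l (mat 1)" for X
      unfolding mat_eq_iff_nth mred_nth mlift_nth by (auto simp: mod_eq_dvd_iff)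
    then have "int l dvd det (mlift (l ^ a) (mat 1) X) \<longleftrightarrow> int l dvd 1" for X
      by (metis det_I dvd_det_mred dvd_refl)
    then have "\<not> int l dvd det (mlift (l ^ a) (mat 1) X)" for X
      using x by simp
    then have "h = (if l dvd k then real l ^ 3 + (real l)\<^sup>2 - real l - 1 else real l ^ 3 - real l)"
      using card_det_nonzero[OF l, of "int N"] lN by (simp add: h_def)
    also have "\<dots> = ((real l)\<^sup>2 - 1) * (if l dvd k then real l + 1 else real l)"
      by (simp add: algebra_simps power2_eq_square power3_eq_cube)
    finally have h: "h = ((real l)\<^sup>2 - 1) * (if l dvd k then real l + 1 else real l)" .
    have "(real l)\<^sup>2 - 1 \<noteq> 0" using x by (auto simp: power2_eq_1_iff)
    moreover have "G = ((real l)\<^sup>2 - 1) * (real l * (real l - 1))"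
      by (simp add: G_def algebra_simps power2_eq_square)
    ultimately have "real l * h / G = (if l dvd k then (real l + 1) / (real l - 1) else real l / (real l - 1))"
      using x unfolding h by simp
    then show ?thesis
      unfolding dens using True lm by (simp add: local_factor_def a_def[symmetric] mult.commute flip: divide_divide_eq_left)
  next
    case False
    then have N: "N = m\<^sup>2 * k" using m'(1) by (simp add: N_def)
    have one: "mlift (l ^ a) (mat 1) X = mat 1 + X" for X
      using False by (simp add: mat_eq_iff_nth)
    \<comment> \<open>The squared symbol records only whether \<open>l\<close> divides
      \<open>N - 1\<close>, the case of the count in which the two eigenvalues coincide.\<close>
    have c: "(of_int (kronecker_prime (int (m\<^sup>2 * k) - 1) l))\<^sup>2 = (if int l dvd int N - 1 then 0 else 1 :: real)"
      using kronecker_prime_sq[OF l, of "int (m\<^sup>2 * k) - 1"] N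
      by (metis of_int_0 of_int_1 of_int_power)
    have h: "h = (if l dvd k then (real l + 1) * ((real l)\<^sup>2 - real l - 1)
       else if int l dvd int N - 1 then real l * ((real l)\<^sup>2 - real l - 1)
       else real l * ((real l)\<^sup>2 - real l - 2))"
      unfolding h_def one card_det_nonzero_invertible[OF l] using lN by simp
    have G: "G = real l * (real l - 1)\<^sup>2 * (real l + 1)"
      by (simp add: G_def algebra_simps power2_eq_square)
    have nz: "(real l - 1)\<^sup>2 \<noteq> 0" "real l + 1 \<noteq> 0" "real l \<noteq> 0" using x by simp_all
    have *: "\<not> l dvd m" using False lm by simp
    have "real l * h / G = local_factor m k l"
    proof (cases "l dvd k")
      case True
      then show ?thesis
        unfolding G h local_factor_def using * nz by simp
    next
      case k: False
      show ?thesis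
      proof (cases "int l dvd int N - 1")
        case True
        have "(real l - 1)\<^sup>2 * (real l + 1) - 1 = real l * ((real l)\<^sup>2 - real l - 1)"
          by (simp add: algebra_simps power2_eq_square)
        with True k show ?thesis
          unfolding G h local_factor_def c using * nz by (simp add: divide_simps)
      next
        case False
        with False k show ?thesis
          unfolding G h local_factor_def c using * nz by (simp add: divide_simps) (simp add: algebra_simps power2_eq_square)
      qed
    qed
    then show ?thesis unfolding dens using False by simp
  qed
qed

section \<open>Endomorphisms of the group\<close>

lemma coprime_int_via_nat_primes:
  fixes a b :: int
  assumes "b \<noteq> 0" "\<And>l. prime l \<Longrightarrow> int l dvd a \<Longrightarrow> int l dvd b \<Longrightarrow> False"
  shows "coprime a b"
proof (rule ccontr)
  assume "\<not> coprime a b"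
  then have "\<not> is_unit (gcd a b)" by (simp add: coprime_iff_gcd_eq_1)
  moreover have "gcd a b \<noteq> 0" using assms(1) by simp
  ultimately obtain p where p: "p dvd gcd a b" "prime p"
    using prime_divisor_exists by blast
  then obtain l where "p = int l" "prime l"
    by (metis prime_ge_0_int zero_le_imp_eq_int prime_nat_int_transfer)
  with p show False using assms(2)[of l] by simp
qed

text \<open>The matrix entries are \<open>\<alpha>, \<beta>, \<gamma>, \<delta>\<close>; the lower left coefficient of the endomorphism itself is \<open>k \<gamma>\<close>.\<close>

definition invertible_at :: "nat \<Rightarrow> nat \<Rightarrow> nat \<Rightarrow> int^2^2 \<Rightarrow> bool" where
  "invertible_at m k l X \<longleftrightarrow>
     (if l dvd m then \<not> int l dvd X $ 1 $ 1 * X $ 2 $ 2 - int k * X $ 1 $ 2 * X $ 2 $ 1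
      else \<not> int l dvd X $ 2 $ 2)"

text \<open>With \<open>D = a d - k b c\<close>, Cramer's rule gives \<open>m | D x\<close> and \<open>m k | D y\<close>. Here \<open>D\<close> is a unit modulo \<open>m\<close>, so \<open>m | x\<close> and then \<open>m k | d y\<close>; although neither \<open>D\<close> nor \<open>d\<close> need be a unit modulo \<open>m k\<close>, their gcd is.\<close>

lemma kernel_trivial:
  fixes X :: "int^2^2"
  assumes mk: "m > 0" "k > 0"
    and inv: "\<And>l. prime l \<Longrightarrow> l dvd m * k \<Longrightarrow> invertible_at m k l X"
    and ker: "int m dvd X $ 1 $ 1 * x + X $ 1 $ 2 * y"
      "int (m * k) dvd int k * X $ 2 $ 1 * x + X $ 2 $ 2 * y"
  shows "int m dvd x \<and> int (m * k) dvd y"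
proof -
  define a b c d D where "a = X $ 1 $ 1" and "b = X $ 1 $ 2" and "c = X $ 2 $ 1" and "d = X $ 2 $ 2"
    and "D = a * d - int k * b * c"
  note defs = a_def[symmetric] b_def[symmetric] c_def[symmetric] d_def[symmetric]
  \<comment> \<open>Primes dividing \<open>m\<close> do not divide \<open>D\<close>; the remaining
    primes dividing \<open>k\<close> do not divide \<open>d\<close>.\<close>
  have prm: "\<not> int l dvd D \<or> \<not> int l dvd d" "l dvd m \<Longrightarrow> \<not> int l dvd D"
    if "prime l" "l dvd m * k" for l
    using that inv unfolding invertible_at_def defs D_def by metis+
  have m: "coprime D (int m)"
    using mk prm(2) by (intro coprime_int_via_nat_primes) auto
  have mk': "coprime (gcd D d) (int (m * k))"
    using mk prm(1) by (intro coprime_int_via_nat_primes) (auto simp del: of_nat_mult)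
  have h1: "int m dvd a * x + b * y" and h2: "int (m * k) dvd int k * c * x + d * y"
    using ker by (simp_all add: a_def b_def c_def d_def)
  have "int m dvd int (m * k)" by simp
  then have h2': "int m dvd int k * c * x + d * y"
    using h2 by (rule dvd_trans)
  have "int m dvd d * (a * x + b * y) - b * (int k * c * x + d * y)"
    using h1 h2' by (intro dvd_diff dvd_mult)
  also have "d * (a * x + b * y) - b * (int k * c * x + d * y) = D * x"
    by (simp add: D_def algebra_simps)
  finally have x: "int m dvd x"
    using m by (metis coprime_commute coprime_dvd_mult_right_iff)
  have kx: "int (m * k) dvd int k * t" if "int m dvd t" for t
    using that by (auto simp: mult.commute)
  have "int (m * k) dvd a * (int k * c * x + d * y) - c * (int k * (a * x + b * y))"
    using h1 h2 by (intro dvd_diff dvd_mult kx)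
  also have "a * (int k * c * x + d * y) - c * (int k * (a * x + b * y)) = D * y"
    by (simp add: D_def algebra_simps)
  finally have Dy: "int (m * k) dvd D * y" .
  have "int (m * k) dvd (int k * c * x + d * y) - int k * (c * x)"
    using h2 x by (intro dvd_diff kx dvd_mult)
  then have dy: "int (m * k) dvd d * y" by (simp add: algebra_simps)
  obtain r s where "r * D + s * d = gcd D d" using bezout_int by blast
  then have "gcd D d * y = r * (D * y) + s * (d * y)"
    by (metis distrib_right mult.assoc)
  then have "int (m * k) dvd gcd D d * y"
    using Dy dy by (simp only: dvd_add dvd_mult)
  then have "int (m * k) dvd y"
    using mk' by (metis coprime_commute coprime_dvd_mult_right_iff)
  with x show ?thesis ..
qed

text \<open>A failure at \<open>l\<close> produces a non-zero kernel element killed by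
  \<open>l\<close>.\<close>

lemma invertible_at_of_kernel_trivial:
  fixes X :: "int^2^2"
  assumes mk: "m > 0" "k > 0"
    and triv: "\<And>x y. int m dvd X $ 1 $ 1 * x + X $ 1 $ 2 * y \<Longrightarrow>
      int (m * k) dvd int k * X $ 2 $ 1 * x + X $ 2 $ 2 * y \<Longrightarrow> int m dvd x \<and> int (m * k) dvd y"
    and l: "prime l" "l dvd m * k"
  shows "invertible_at m k l X"
proof -
  define a b c d where "a = X $ 1 $ 1" and "b = X $ 1 $ 2" and "c = X $ 2 $ 1" and "d = X $ 2 $ 2"
  note defs = a_def[symmetric] b_def[symmetric] c_def[symmetric] d_def[symmetric]
  have ker: "int m dvd x \<and> int (m * k) dvd y"
    if "int m dvd a * x + b * y" "int (m * k) dvd int k * c * x + d * y" for x y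
    using triv[of x y] that by (simp only: a_def b_def c_def d_def)
  have unit: "\<not> int l dvd 1" using l prime_gt_1_nat[of l] by auto
  show "invertible_at m k l X"
  proof (cases "l dvd m")
    case True
    then obtain m1 where m1: "m = l * m1" by blast
    with mk have m1pos: "m1 > 0" by simp
    \<comment> \<open>\<open>(m1 * u, m1 * k * v)\<close> runs through the \<open>l\<close>-torsion,
      on which the endomorphism acts by the matrix with rows \<open>(a, k b)\<close> and
      \<open>(c, d)\<close> modulo \<open>l\<close>.\<close>
    have uv: "int l dvd u \<and> int l dvd v"
      if "int l dvd a * u + int k * b * v" "int l dvd c * u + d * v" for u v
    proof -
      have "int m1 * int l dvd int m1 * (a * u + int k * b * v)"
        using that(1) by (rule mult_dvd_mono[OF dvd_refl])
      then have "int m dvd a * (int m1 * u) + b * (int (m1 * k) * v)"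
        by (simp add: m1 algebra_simps)
      moreover have "int (m1 * k) * int l dvd int (m1 * k) * (c * u + d * v)"
        using that(2) by (rule mult_dvd_mono[OF dvd_refl])
      then have "int (m * k) dvd int k * c * (int m1 * u) + d * (int (m1 * k) * v)"
        by (simp add: m1 algebra_simps)
      ultimately have "int m dvd int m1 * u \<and> int (m * k) dvd int (m1 * k) * v"
        by (rule ker)
      then have "int m1 * int l dvd int m1 * u" "int (m1 * k) * int l dvd int (m1 * k) * v"
        by (simp_all add: m1 mult_ac)
      then show ?thesis using m1pos mk by simp
    qed
    have "\<not> int l dvd a * d - int k * b * c"
    proof
      assume D: "int l dvd a * d - int k * b * c"
      \<comment> \<open>If the determinant vanishes, the adjugate columns \<open>(d, -c)\<close> and
        \<open>(k b, -a)\<close> lie in the kernel, so every entry vanishes modulo \<open>l\<close>;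
        then so does the image of \<open>(1, 0)\<close>, a contradiction.\<close>
      have cd: "int l dvd d \<and> int l dvd - c"
        using D by (intro uv) (simp_all add: algebra_simps)
      have "int l dvd int k * b \<and> int l dvd - a"
      proof (rule uv)
        show "int l dvd c * (int k * b) + d * - a"
          using cd by (intro dvd_add) (auto simp: dvd_mult2)
      qed (simp add: algebra_simps)
      then have "int l dvd 1 \<and> int l dvd 0"
        using cd by (intro uv) simp_all
      with unit show False by blast
    qed
    with True show ?thesis by (simp add: invertible_at_def defs)
  next
    case False
    with l have "l dvd k" by (simp add: prime_dvd_mult_iff)
    then obtain k1 where k1: "k = l * k1" by blast
    have "\<not> int l dvd d"
    proof
      assume "int l dvd d"
      then have "int (m * k1) * int l dvd int (m * k1) * d"
        by (rule mult_dvd_mono[OF dvd_refl])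
      \<comment> \<open>The kernel element is \<open>(0, m * k1)\<close>, of order \<open>l\<close>
        in the second factor.\<close>
      then have "int m dvd 0 \<and> int (m * k) dvd int (m * k1)"
        by (intro ker) (simp_all add: k1 mult_ac)
      then have "int (m * k1) * int l dvd int (m * k1) * 1" by (simp add: k1 mult_ac)
      then show False using unit mk k1 by (subst (asm) dvd_mult_cancel_left) simp
    qed
    with False show ?thesis by (simp add: invertible_at_def defs)
  qed
qed

text \<open>The image of \<open>(1, 0)\<close> is killed by \<open>m\<close>, which forces the
  factor \<open>k\<close> in the second coordinate. The map is restricted to the carrier because
  members of \<open>auto\<close> are extensional.\<close>

definition endo :: "nat \<Rightarrow> nat \<Rightarrow> int^2^2 \<Rightarrow> int \<times> int \<Rightarrow> int \<times> int" where
  "endo m k X = (\<lambda>(x, y) \<in> {0..<int m} \<times> {0..<int (m * k)}.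
     ((X $ 1 $ 1 * x + X $ 1 $ 2 * y) mod int m, (int k * X $ 2 $ 1 * x + X $ 2 $ 2 * y) mod int (m * k)))"

text \<open>The lower left entry matters only modulo \<open>m\<close>, since it enters as a multiple
  of \<open>k\<close> modulo \<open>m * k\<close>. With these ranges every endomorphism has exactly
  one coefficient matrix.\<close>

definition endo_coeffs :: "nat \<Rightarrow> nat \<Rightarrow> (int^2^2) set" where
  "endo_coeffs m k = {X. X $ 1 $ 1 \<in> {0..<int m} \<and> X $ 1 $ 2 \<in> {0..<int m} \<and>
     X $ 2 $ 1 \<in> {0..<int m} \<and> X $ 2 $ 2 \<in> {0..<int (m * k)}}"

section \<open>Homomorphisms given by coefficient matrices\<close>

lemma carrier_rank2_group:
  "m > 0 \<Longrightarrow> k > 0 \<Longrightarrow> carrier (rank2_group m k) = {0..<int m} \<times> {0..<int (m * k)}"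
  by (simp add: rank2_group_def carrier_integer_mod_group)

lemma mult_rank2_group:
  "(x, y) \<otimes>\<^bsub>rank2_group m k\<^esub> (x', y') = ((x + x') mod int m, (y + y') mod int (m * k))"
  by (simp add: rank2_group_def)

lemma endo_apply:
  assumes "x \<in> {0..<int m}" "y \<in> {0..<int (m * k)}"
  shows "endo m k X (x, y) =
    ((X $ 1 $ 1 * x + X $ 1 $ 2 * y) mod int m, (int k * X $ 2 $ 1 * x + X $ 2 $ 2 * y) mod int (m * k))"
  using assms by (simp add: endo_def)

text \<open>Well-definedness on classes: \<open>x\<close> modulo \<open>m\<close> determines
  \<open>k * x\<close> modulo \<open>m * k\<close>, and \<open>y\<close> modulo \<open>m * k\<close>
  determines \<open>y\<close> modulo \<open>m\<close>.\<close>

lemma endo_mod: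
  assumes "m > 0" "k > 0"
  shows "endo m k X (x mod int m, y mod int (m * k)) =
    ((X $ 1 $ 1 * x + X $ 1 $ 2 * y) mod int m, (int k * X $ 2 $ 1 * x + X $ 2 $ 2 * y) mod int (m * k))"
proof -
  have x: "[x mod int m = x] (mod int m)" and y: "[y mod int (m * k) = y] (mod int (m * k))"
    by (simp_all add: cong_def)
  have y': "[y mod int (m * k) = y] (mod int m)"
    using y by (rule cong_dvd_modulus) simp
  have kx: "[int k * (x mod int m) = int k * x] (mod int (m * k))"
    unfolding cong_iff_dvd_diff right_diff_distrib[symmetric] of_nat_mult mult.commute[of "int m"]
    using x by (intro mult_dvd_mono dvd_refl) (simp only: cong_iff_dvd_diff)
  have "[X $ 1 $ 1 * (x mod int m) + X $ 1 $ 2 * (y mod int (m * k)) = X $ 1 $ 1 * x + X $ 1 $ 2 * y] (mod int m)"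
    by (intro cong_add cong_mult cong_refl x y')
  moreover have "[X $ 2 $ 1 * (int k * (x mod int m)) + X $ 2 $ 2 * (y mod int (m * k)) = X $ 2 $ 1 * (int k * x) + X $ 2 $ 2 * y] (mod int (m * k))"
    by (intro cong_add cong_mult cong_refl kx y)
  ultimately show ?thesis
    using assms by (simp add: endo_apply cong_def mult_ac)
qed

lemma group_rank2_group: "group (rank2_group m k)"
  unfolding rank2_group_def by (intro DirProd_group group_integer_mod_group)

lemma endo_hom:
  assumes "m > 0" "k > 0"
  shows "endo m k X \<in> hom (rank2_group m k) (rank2_group m k)"
proof (rule homI)
  fix p assume "p \<in> carrier (rank2_group m k)"
  then show "endo m k X p \<in> carrier (rank2_group m k)"
    using assms by (auto simp: carrier_rank2_group endo_apply simp del: of_nat_mult)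
next
  fix p q assume "p \<in> carrier (rank2_group m k)" "q \<in> carrier (rank2_group m k)"
  moreover obtain x y x' y' where "p = (x, y)" "q = (x', y')" by (cases p, cases q)
  moreover have "((X $ 1 $ 1 * (x + x') + X $ 1 $ 2 * (y + y')) mod int m =
      ((X $ 1 $ 1 * x + X $ 1 $ 2 * y) mod int m + (X $ 1 $ 1 * x' + X $ 1 $ 2 * y') mod int m) mod int m)"
    unfolding mod_add_eq by (simp add: algebra_simps)
  moreover have "((int k * X $ 2 $ 1 * (x + x') + X $ 2 $ 2 * (y + y')) mod int (m * k) =
      ((int k * X $ 2 $ 1 * x + X $ 2 $ 2 * y) mod int (m * k) + (int k * X $ 2 $ 1 * x' + X $ 2 $ 2 * y') mod int (m * k)) mod int (m * k))"
    unfolding mod_add_eq by (simp add: algebra_simps)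
  ultimately show "endo m k X (p \<otimes>\<^bsub>rank2_group m k\<^esub> q) = endo m k X p \<otimes>\<^bsub>rank2_group m k\<^esub> endo m k X q"
    using assms by (simp add: carrier_rank2_group mult_rank2_group endo_mod del: of_nat_mult)
      (simp add: endo_apply mult_rank2_group del: of_nat_mult)
qed

lemma inj_on_endo_iff:
  assumes mk: "m > 0" "k > 0"
  shows "inj_on (endo m k X) (carrier (rank2_group m k)) \<longleftrightarrow>
    (\<forall>l. prime l \<and> l dvd m * k \<longrightarrow> invertible_at m k l X)"
proof
  assume inj: "inj_on (endo m k X) (carrier (rank2_group m k))"
  have "int m dvd x \<and> int (m * k) dvd y"
    if xy: "int m dvd X $ 1 $ 1 * x + X $ 1 $ 2 * y" "int (m * k) dvd int k * X $ 2 $ 1 * x + X $ 2 $ 2 * y" for x y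
  proof -
    have "endo m k X (x mod int m, y mod int (m * k)) = (0, 0)"
      unfolding endo_mod[OF mk] using xy by (simp only: dvd_eq_mod_eq_0)
    also have "\<dots> = endo m k X (0, 0)"
      using mk by (simp add: endo_apply)
    finally have "(x mod int m, y mod int (m * k)) = (0, 0)"
      by (rule inj_onD[OF inj]) (use mk in \<open>auto simp: carrier_rank2_group simp del: of_nat_mult\<close>)
    then show ?thesis by (simp only: dvd_eq_mod_eq_0) simp
  qed
  then show "\<forall>l. prime l \<and> l dvd m * k \<longrightarrow> invertible_at m k l X"
    using invertible_at_of_kernel_trivial[OF mk] by blast
next
  assume inv: "\<forall>l. prime l \<and> l dvd m * k \<longrightarrow> invertible_at m k l X"
  show "inj_on (endo m k X) (carrier (rank2_group m k))"
  proof (rule inj_onI)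
    fix p q assume pq: "p \<in> carrier (rank2_group m k)" "q \<in> carrier (rank2_group m k)"
      and eq: "endo m k X p = endo m k X q"
    obtain x y x' y' where p: "p = (x, y)" and q: "q = (x', y')" by (cases p, cases q)
    have xy: "x \<in> {0..<int m}" "y \<in> {0..<int (m * k)}" "x' \<in> {0..<int m}" "y' \<in> {0..<int (m * k)}"
      using pq mk by (simp_all add: p q carrier_rank2_group)
    have "(X $ 1 $ 1 * x + X $ 1 $ 2 * y) mod int m = (X $ 1 $ 1 * x' + X $ 1 $ 2 * y') mod int m"
      "(int k * X $ 2 $ 1 * x + X $ 2 $ 2 * y) mod int (m * k) = (int k * X $ 2 $ 1 * x' + X $ 2 $ 2 * y') mod int (m * k)"
      using eq xy by (simp_all add: p q endo_apply del: of_nat_mult)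
    then have "int m dvd X $ 1 $ 1 * (x - x') + X $ 1 $ 2 * (y - y')"
      "int (m * k) dvd int k * X $ 2 $ 1 * (x - x') + X $ 2 $ 2 * (y - y')"
      by (simp_all add: mod_eq_dvd_iff algebra_simps)
    then have "int m dvd x - x' \<and> int (m * k) dvd y - y'"
      using inv by (intro kernel_trivial[OF mk]) blast+
    then have "x mod int m = x' mod int m" "y mod int (m * k) = y' mod int (m * k)"
      by (simp_all only: mod_eq_dvd_iff)
    then show "p = q" using xy by (simp add: p q del: of_nat_mult)
  qed
qed

text \<open>A homomorphism is determined by the images \<open>(a, g)\<close> and
  \<open>(b, d)\<close> of the two generators, and the relation that \<open>m\<close> kills the
  first generator makes \<open>g\<close> a multiple of \<open>k\<close>.\<close>

lemma endo_exists:
  assumes mk: "m > 0" "k > 0" and f: "f \<in> hom (rank2_group m k) (rank2_group m k)"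
    and ext: "f \<in> extensional (carrier (rank2_group m k))"
  shows "\<exists>X\<in>endo_coeffs m k. f = endo m k X"
proof -
  let ?m = "int m" and ?M = "int (m * k)"
  have pos: "?m > 0" "?M > 0" using mk by simp_all
  note [simp del] = of_nat_mult
  \<comment> \<open>The generator is written \<open>1 mod ?m\<close> so that it lies in the carrier
    also for \<open>m = 1\<close>, where it is \<open>0\<close>.\<close>
  define a g where "a = fst (f (1 mod ?m, 0))" and "g = snd (f (1 mod ?m, 0))"
  define b d where "b = fst (f (0, 1 mod ?M))" and "d = snd (f (0, 1 mod ?M))"
  have carr: "p \<in> carrier (rank2_group m k) \<longleftrightarrow> fst p \<in> {0..<?m} \<and> snd p \<in> {0..<?M}" for p
    using mk by (cases p) (simp add: carrier_rank2_group)
  have ag: "f (1 mod ?m, 0) \<in> carrier (rank2_group m k)" "f (0, 1 mod ?M) \<in> carrier (rank2_group m k)"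
    using pos by (intro hom_in_carrier[OF f]; simp add: carr)+
  have add: "f ((x + x') mod ?m, (y + y') mod ?M) =
      ((fst (f (x, y)) + fst (f (x', y'))) mod ?m, (snd (f (x, y)) + snd (f (x', y'))) mod ?M)"
    if "x \<in> {0..<?m}" "x' \<in> {0..<?m}" "y \<in> {0..<?M}" "y' \<in> {0..<?M}" for x y x' y'
    using hom_mult[OF f, of "(x, y)" "(x', y')"] that
    by (cases "f (x, y)", cases "f (x', y')") (simp add: carr mult_rank2_group)
  have zero: "f (0, 0) = (0, 0)"
    using hom_one[OF f group_rank2_group group_rank2_group] by (simp add: rank2_group_def)
  have fst_part: "f (int n mod ?m, 0) = ((a * int n) mod ?m, (g * int n) mod ?M)" for n
  proof (induction n)
    case 0
    show ?case using zero by simp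
  next
    case (Suc n)
    have "f (int (Suc n) mod ?m, 0) = f ((int n mod ?m + 1 mod ?m) mod ?m, (0 + 0) mod ?M)"
      by (simp add: mod_add_eq add.commute)
    also have "\<dots> = (((a * int n) mod ?m + a) mod ?m, ((g * int n) mod ?M + g) mod ?M)"
      by (subst add) (use pos Suc in \<open>auto simp: a_def g_def\<close>)
    finally show ?case by (simp add: mod_add_left_eq mod_add_right_eq algebra_simps)
  qed
  have snd_part: "f (0, int n mod ?M) = ((b * int n) mod ?m, (d * int n) mod ?M)" for n
  proof (induction n)
    case 0
    show ?case using zero by simp
  next
    case (Suc n)
    have "f (0, int (Suc n) mod ?M) = f ((0 + 0) mod ?m, (int n mod ?M + 1 mod ?M) mod ?M)"
      by (simp add: mod_add_eq add.commute)
    also have "\<dots> = (((b * int n) mod ?m + b) mod ?m, ((d * int n) mod ?M + d) mod ?M)"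
      by (subst add) (use pos Suc in \<open>auto simp: b_def d_def\<close>)
    finally show ?case by (simp add: mod_add_left_eq mod_add_right_eq algebra_simps)
  qed
  have f_eq: "f (x, y) = ((a * x + b * y) mod ?m, (g * x + d * y) mod ?M)"
    if "x \<in> {0..<?m}" "y \<in> {0..<?M}" for x y
  proof -
    have "f (x, y) = f ((x + 0) mod ?m, (0 + y) mod ?M)" using that by simp
    also have "\<dots> = ((fst (f (x, 0)) + fst (f (0, y))) mod ?m, (snd (f (x, 0)) + snd (f (0, y))) mod ?M)"
      by (rule add) (use pos that in auto)
    also have "f (x, 0) = ((a * x) mod ?m, (g * x) mod ?M)"
      using fst_part[of "nat x"] that by simp
    also have "f (0, y) = ((b * y) mod ?m, (d * y) mod ?M)"
      using snd_part[of "nat y"] that by simp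
    finally show ?thesis by (simp add: mod_add_eq)
  qed
  \<comment> \<open>The formula for multiples of the first generator, taken at
    \<open>n = m\<close>.\<close>
  have "?M dvd g * ?m"
    using fst_part[of m] zero by (simp add: dvd_eq_mod_eq_0)
  then have "int k dvd g"
    using mk by (simp add: of_nat_mult mult.commute[of g])
  then obtain c where c: "g = int k * c" by blast
  define X where "X = mat22 a b c d"
  have "g \<in> {0..<?M}" using ag by (simp add: carr g_def)
  then have "c \<in> {0..<?m}"
    using mk by (simp add: c zero_le_mult_iff of_nat_mult mult.commute[of ?m])
  then have "X \<in> endo_coeffs m k"
    using ag by (simp add: endo_coeffs_def X_def carr a_def b_def d_def)
  moreover have "f = endo m k X"
  proof (rule extensionalityI[OF ext])
    show "endo m k X \<in> extensional (carrier (rank2_group m k))"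
      using mk by (simp add: endo_def carrier_rank2_group)
    fix p assume "p \<in> carrier (rank2_group m k)"
    then show "f p = endo m k X p"
      by (cases p) (simp add: carr f_eq endo_apply X_def c)
  qed
  ultimately show ?thesis by blast
qed

lemma inj_on_endo_coeffs:
  assumes mk: "m > 0" "k > 0"
  shows "inj_on (endo m k) (endo_coeffs m k)"
proof (rule inj_onI)
  note [simp del] = of_nat_mult
  fix X Y assume XY: "X \<in> endo_coeffs m k" "Y \<in> endo_coeffs m k" and eq: "endo m k X = endo m k Y"
  have e1: "endo m k Z (1 mod int m, 0) = (Z $ 1 $ 1, int k * Z $ 2 $ 1)" if "Z \<in> endo_coeffs m k" for Z
  proof -
    have "int k * Z $ 2 $ 1 \<in> {0..<int (m * k)}"
      using that mk by (simp add: endo_coeffs_def of_nat_mult mult.commute[of "int m"])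
    then show ?thesis
      using endo_mod[OF mk, of Z 1 0] that by (simp add: endo_coeffs_def)
  qed
  have e2: "endo m k Z (0, 1 mod int (m * k)) = (Z $ 1 $ 2, Z $ 2 $ 2)" if "Z \<in> endo_coeffs m k" for Z
    using endo_mod[OF mk, of Z 0 1] that by (simp add: endo_coeffs_def)
  have "X $ 1 $ 1 = Y $ 1 $ 1" "int k * X $ 2 $ 1 = int k * Y $ 2 $ 1" "X $ 1 $ 2 = Y $ 1 $ 2" "X $ 2 $ 2 = Y $ 2 $ 2"
    using e1[of X] e1[of Y] e2[of X] e2[of Y] XY eq mk by simp_all
  then show "X = Y" using mk by (simp add: mat_eq_iff_nth forall_2)
qed

text \<open>On a finite carrier an injective endomorphism is bijective, so the prime-by-prime
  injectivity criterion describes the automorphisms.\<close>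

lemma bij_endo_auto:
  assumes mk: "m > 0" "k > 0"
  shows "bij_betw (endo m k)
    {X \<in> endo_coeffs m k. \<forall>l. prime l \<and> l dvd m * k \<longrightarrow> invertible_at m k l X} (auto (rank2_group m k))"
  unfolding bij_betw_def
proof
  let ?G = "rank2_group m k"
  have fin: "finite (carrier ?G)" using mk by (simp add: carrier_rank2_group)
  have sub: "endo m k X ` carrier ?G \<subseteq> carrier ?G" for X
    using hom_in_carrier[OF endo_hom[OF mk]] by blast
  show "inj_on (endo m k) {X \<in> endo_coeffs m k. \<forall>l. prime l \<and> l dvd m * k \<longrightarrow> invertible_at m k l X}"
    using inj_on_endo_coeffs[OF mk] by (rule inj_on_subset) blast
  show "endo m k ` {X \<in> endo_coeffs m k. \<forall>l. prime l \<and> l dvd m * k \<longrightarrow> invertible_at m k l X} = auto ?G"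
  proof (intro equalityI subsetI)
    fix f assume "f \<in> endo m k ` {X \<in> endo_coeffs m k. \<forall>l. prime l \<and> l dvd m * k \<longrightarrow> invertible_at m k l X}"
    then obtain X where f: "f = endo m k X" and inj: "inj_on f (carrier ?G)"
      using inj_on_endo_iff[OF mk] by blast
    moreover have "f ` carrier ?G = carrier ?G"
      using endo_inj_surj[OF fin _ inj] sub f by blast
    moreover have "f \<in> extensional (carrier ?G)"
      using mk by (simp add: f endo_def carrier_rank2_group)
    ultimately show "f \<in> auto ?G"
      using endo_hom[OF mk] by (simp add: auto_def Bij_def bij_betw_def)
  next
    fix f assume f: "f \<in> auto ?G"
    then obtain X where X: "X \<in> endo_coeffs m k" "f = endo m k X"
      using endo_exists[OF mk] by (auto simp: auto_def Bij_def)
    moreover have "inj_on f (carrier ?G)"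
      using f by (simp add: auto_def Bij_def bij_betw_def)
    ultimately show "f \<in> endo m k ` {X \<in> endo_coeffs m k. \<forall>l. prime l \<and> l dvd m * k \<longrightarrow> invertible_at m k l X}"
      using inj_on_endo_iff[OF mk] by blast
  qed
qed

section \<open>The order of the automorphism group\<close>

lemma invertible_at_mred: "invertible_at m k l (mred l X) \<longleftrightarrow> invertible_at m k l X"
proof -
  have c: "[mred l X $ i $ j = X $ i $ j] (mod int l)" for i j
    by (simp add: cong_def)
  have "[mred l X $ 1 $ 1 * mred l X $ 2 $ 2 - int k * mred l X $ 1 $ 2 * mred l X $ 2 $ 1
      = X $ 1 $ 1 * X $ 2 $ 2 - int k * X $ 1 $ 2 * X $ 2 $ 1] (mod int l)"
    by (intro cong_diff cong_mult c cong_refl)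
  then show ?thesis
    unfolding invertible_at_def using cong_dvd_iff c by metis
qed

text \<open>Every matrix modulo \<open>m k\<close> arises from \<open>k\<^sup>3\<close> choices of digits, which puts the coefficients \<open>\<alpha>, \<beta>, \<gamma>\<close> (known only modulo \<open>m\<close>) on the same footing as \<open>\<delta>\<close>.\<close>

lemma bij_endo_coeffs_mats:
  assumes mk: "m > 0" "k > 0"
  shows "bij_betw (\<lambda>(X, i, j, h). mat22 (X $ 1 $ 1 + int m * i) (X $ 1 $ 2 + int m * j) (X $ 2 $ 1 + int m * h) (X $ 2 $ 2))
    (endo_coeffs m k \<times> {0..<int k} \<times> {0..<int k} \<times> {0..<int k}) (mats (m * k))"
proof -
  have lt: "x + int m * i \<in> {0..<int (m * k)}" if "x \<in> {0..<int m}" "i \<in> {0..<int k}" for x i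
  proof -
    have "x + int m * i < int m * (1 + i)" using that by (simp add: distrib_left)
    moreover have "int m * (1 + i) \<le> int m * int k" using that by (intro mult_left_mono) simp_all
    ultimately have "x + int m * i < int m * int k" by (rule less_le_trans)
    then show ?thesis using that by simp
  qed
  have dv: "x div int m \<in> {0..<int k}" if "x \<in> {0..<int (m * k)}" for x
  proof -
    have "int m * (x div int m) \<le> x"
      using mk by (simp flip: minus_mod_eq_mult_div)
    also have "x < int m * int k" using that by simp
    finally have "x div int m < int k" using mk by simp
    then show ?thesis using that mk by (simp add: pos_imp_zdiv_nonneg_iff)
  qed
  have dm: "(x + int m * i) mod int m = x" "(x + int m * i) div int m = i" if "x \<in> {0..<int m}" for x i
    using that by simp_all
  note [simp del] = of_nat_mult
  show ?thesis
  proof (rule bij_betwI[where g = "\<lambda>Y. (mat22 (Y $ 1 $ 1 mod int m) (Y $ 1 $ 2 mod int m) (Y $ 2 $ 1 mod int m) (Y $ 2 $ 2),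
        Y $ 1 $ 1 div int m, Y $ 1 $ 2 div int m, Y $ 2 $ 1 div int m)"], goal_cases)
    case 1
    show ?case
    proof (rule Pi_I, clarify, goal_cases)
      case (1 X i j h)
      then show ?case
        using lt[of "X $ 1 $ 1" i] lt[of "X $ 1 $ 2" j] lt[of "X $ 2 $ 1" h]
        by (simp add: mats_def endo_coeffs_def forall_2)
    qed
  next
    case 2
    show ?case
    proof (rule Pi_I, goal_cases)
      case (1 Y)
      then show ?case
        using dv[of "Y $ 1 $ 1"] dv[of "Y $ 1 $ 2"] dv[of "Y $ 2 $ 1"] mk
        by (simp add: mats_def endo_coeffs_def)
    qed
  next
    case (3 p)
    then show ?case
      by (cases p) (simp add: endo_coeffs_def mat_eq_iff_nth forall_2 dm)
  next
    case (4 Y)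
    then show ?case by (simp add: mat_eq_iff_nth forall_2)
  qed
qed

text \<open>The \<open>k ^ 3\<close> digit choices turn coefficient matrices into all matrices
  modulo \<open>m * k\<close>, whose good proportion factors over primes; dividing
  \<open>(m * k) ^ 4\<close> by \<open>k ^ 3\<close> leaves \<open>m ^ 4 * k\<close>.\<close>

lemma order_AutoGroup_rank2_group:
  assumes mk: "m > 0" "k > 0"
  shows "real (order (AutoGroup (rank2_group m k))) = real m ^ 4 * real k *
    (\<Prod>l\<in>prime_factors (m * k).
      if l dvd m then if l dvd k then (1 - 1 / real l)\<^sup>2 else (1 - 1 / (real l)\<^sup>2) * (1 - 1 / real l)
      else 1 - 1 / real l)"
    (is "_ = _ * prod ?f _")
proof -
  let ?inv = "\<lambda>X. \<forall>l. prime l \<and> l dvd m * k \<longrightarrow> invertible_at m k l X"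
  define \<phi> where "\<phi> = (\<lambda>(X :: int^2^2, i, j, h). mat22 (X $ 1 $ 1 + int m * i) (X $ 1 $ 2 + int m * j) (X $ 2 $ 1 + int m * h) (X $ 2 $ 2))"
  let ?I = "{0..<int k} \<times> {0..<int k} \<times> {0..<int k}"
  have "order (AutoGroup (rank2_group m k)) = card (auto (rank2_group m k))"
    by (simp add: order_def AutoGroup_def)
  then have aut: "order (AutoGroup (rank2_group m k)) = card {X \<in> endo_coeffs m k. ?inv X}"
    using bij_betw_same_card[OF bij_endo_auto[OF mk]] by simp
  \<comment> \<open>The added digits are multiples of \<open>m\<close>, invisible at primes dividing
    \<open>m\<close>; at other primes only the unchanged lower right entry is tested.\<close>
  have "invertible_at m k l (\<phi> (X, p)) \<longleftrightarrow> invertible_at m k l X" for l X p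
  proof (cases "l dvd m")
    case True
    then have "int l dvd int m" by simp
    then have "mred l (\<phi> (X, p)) = mred l X"
      by (cases p) (auto simp: \<phi>_def mat_eq_iff_nth forall_2 mod_eq_dvd_iff)
    then show ?thesis by (metis invertible_at_mred)
  next
    case False
    then show ?thesis by (cases p) (simp add: \<phi>_def invertible_at_def)
  qed
  then have "?inv (\<phi> q) \<longleftrightarrow> ?inv (fst q)" for q
    by (cases q) simp
  then have "{q \<in> endo_coeffs m k \<times> ?I. ?inv (\<phi> q)} = {X \<in> endo_coeffs m k. ?inv X} \<times> ?I"
    by (simp only: set_eq_iff mem_Collect_eq mem_Times_iff conj_ac simp_thms)
  moreover have "card {X \<in> mats (m * k). ?inv X} = card {q \<in> endo_coeffs m k \<times> ?I. ?inv (\<phi> q)}"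
    by (rule card_bij_Collect) (unfold \<phi>_def, rule bij_endo_coeffs_mats[OF mk])
  ultimately have "card {X \<in> mats (m * k). ?inv X} = card {X \<in> endo_coeffs m k. ?inv X} * k ^ 3"
    by (simp only: card_cartesian_product) (simp add: card_cartesian_product power3_eq_cube)
  moreover have "real (card {X \<in> mats (m * k). ?inv X}) =
      real (m * k) ^ 4 * (\<Prod>l\<in>prime_factors (m * k). real (card {X \<in> mats l. invertible_at m k l X}) / real l ^ 4)"
    using card_mats_prime_divisors[of "m * k" "invertible_at m k"] mk
    unfolding invertible_at_mred by simp
  moreover have "(\<Prod>l\<in>prime_factors (m * k). real (card {X \<in> mats l. invertible_at m k l X}) / real l ^ 4)
      = (\<Prod>l\<in>prime_factors (m * k). ?f l)"
  proof (intro prod.cong refl)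
    fix l assume "l \<in> prime_factors (m * k)"
    then have l: "prime l" by auto
    show "real (card {X \<in> mats l. invertible_at m k l X}) / real l ^ 4 = ?f l"
      using card_not_twisted_det[OF l, of "int k"] card_not_dvd_entry[OF l]
      by (simp add: invertible_at_def)
  qed
  ultimately have "real (card {X \<in> endo_coeffs m k. ?inv X}) * real k ^ 3 = real (m * k) ^ 4 * prod ?f (prime_factors (m * k))"
    by (simp del: of_nat_mult flip: of_nat_power of_nat_mult)
  also have "\<dots> = (real m ^ 4 * real k * prod ?f (prime_factors (m * k))) * real k ^ 3"
    by (simp add: power_mult_distrib power4_eq_xxxx power3_eq_cube)
  finally show ?thesis
    using mk unfolding aut by simp
qed

theorem theoremA2:
  fixes m k :: nat
  assumes "m > 0" and "k > 0"
  shows "(\<lambda>l. if prime l then lim (matrix_density m k l) else 1) has_prod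
           (K_const m k * real (order (rank2_group m k))
            / real (order (AutoGroup (rank2_group m k))))
         \<and> (\<forall>l. prime l \<longrightarrow>
              (\<exists>c. \<forall>e > multiplicity l (order (rank2_group m k)). matrix_density m k l e = c))"
proof
  note mk = assms
  define N where "N = m\<^sup>2 * k"
  have N: "order (rank2_group m k) = N" "N > 0"
    using mk by (simp_all add: order_rank2_group N_def)
  show "\<forall>l. prime l \<longrightarrow>
      (\<exists>c. \<forall>e > multiplicity l (order (rank2_group m k)). matrix_density m k l e = c)"
    using matrix_density_eq_local_factor[OF _ mk] by blast
  have lim: "lim (matrix_density m k l) = local_factor m k l" if "prime l" for l
  proof (rule limI, rule tendsto_eventually)
    show "\<forall>\<^sub>F e in sequentially. matrix_density m k l e = local_factor m k l"
      using eventually_gt_at_top matrix_density_eq_local_factor[OF that mk] by (rule eventually_mono)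
  qed
  let ?P = "prime_factors N"
  have P: "l \<in> ?P \<longleftrightarrow> prime l \<and> (l dvd m \<or> l dvd k)" for l
    using mk by (auto simp: N_def in_prime_factors_iff prime_dvd_mult_iff prime_dvd_power_iff)
  have P': "?P = prime_factors (m * k)"
    unfolding set_eq_iff P using mk by (auto simp: in_prime_factors_iff prime_dvd_mult_iff)
  \<comment> \<open>\<open>F\<close> is the infinite part of \<open>K_const\<close>,
    \<open>t\<close> gives its finitely many other factors, and \<open>f\<close> gives the factors
    of the automorphism count.\<close>
  define F where "F l = (if prime l \<and> \<not> l dvd N
      then 1 - ((of_int (kronecker_prime (int N - 1) l))\<^sup>2 * real l + 1) / ((real l - 1)\<^sup>2 * (real l + 1)) else 1)" for l
  define t where "t l = (if l dvd m then 1 - 1 / (real l)\<^sup>2 else 1 - 1 / (real l * (real l - 1)))" for l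
  define f where "f l = (if l dvd m then if l dvd k then (1 - 1 / real l)\<^sup>2 else (1 - 1 / (real l)\<^sup>2) * (1 - 1 / real l)
      else 1 - 1 / real l)" for l
  have K: "K_const m k = prodinf F * prod t ?P"
  proof -
    have fin: "finite {l. prime l \<and> l dvd m}" "finite {l. prime l \<and> l dvd k \<and> \<not> l dvd m}"
      using finite_set_mset[of "prime_factorization N"] P by (auto intro: finite_subset[of _ ?P])
    have "?P = {l. prime l \<and> l dvd m} \<union> {l. prime l \<and> l dvd k \<and> \<not> l dvd m}"
      using P by auto
    then have "prod t ?P = (\<Prod>l | prime l \<and> l dvd m. t l) * (\<Prod>l | prime l \<and> l dvd k \<and> \<not> l dvd m. t l)"
      using fin by (simp only:) (rule prod.union_disjoint; auto)
    then show ?thesis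
      by (simp add: K_const_def Let_def N F_def[abs_def] t_def mult.assoc)
  qed
  have local_eq: "local_factor m k l = t l / (real l ^ (2 * multiplicity l m) * f l)" if "l \<in> ?P" for l
  proof -
    have l: "prime l" "l dvd m \<or> l dvd k" using that P by auto
    have x: "real l > 1" using prime_gt_1_nat[OF l(1)] by simp
    show ?thesis
    proof (cases "l dvd m")
      case True
      have "(real l)\<^sup>2 - 1 = (real l - 1) * (real l + 1)"
        by (simp add: algebra_simps power2_eq_square)
      moreover from this have "t l = (real l - 1) * (real l + 1) / (real l)\<^sup>2"
        using x True by (simp add: t_def divide_simps)
      moreover from this have "t l \<noteq> 0"
        using x by simp
      moreover have "f l = (if l dvd k then (real l - 1)\<^sup>2 / (real l)\<^sup>2 else t l * ((real l - 1) / real l))"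
        using x True by (simp add: f_def t_def divide_simps)
      ultimately show ?thesis
        using x True by (simp add: local_factor_def divide_simps power2_eq_square)
    next
      case False
      with l have "l dvd k" by simp
      moreover have "multiplicity l m = 0"
        using False by (simp add: not_dvd_imp_multiplicity_0)
      ultimately show ?thesis
        using x False by (simp add: local_factor_def t_def f_def divide_simps power2_eq_square)
          (simp add: algebra_simps)
    qed
  qed
  have "(\<Prod>l\<in>?P. real l ^ (2 * multiplicity l m)) = (real m)\<^sup>2"
  proof -
    have "m = (\<Prod>l\<in>?P. l ^ multiplicity l m)"
    proof -
      have "m = (\<Prod>l\<in>prime_factors m. l ^ multiplicity l m)"
        using mk(1) by (rule prime_factorization_nat)
      also have "\<dots> = (\<Prod>l\<in>?P. l ^ multiplicity l m)"
      proof (rule prod.mono_neutral_left)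
        show "prime_factors m \<subseteq> ?P"
          using P by (auto dest: in_prime_factors_imp_dvd)
        show "\<forall>l\<in>?P - prime_factors m. l ^ multiplicity l m = 1"
        proof
          fix l assume "l \<in> ?P - prime_factors m"
          then have "\<not> l dvd m" using mk by (auto simp: in_prime_factors_iff)
          then show "l ^ multiplicity l m = 1" by (simp add: not_dvd_imp_multiplicity_0)
        qed
      qed simp
      finally show ?thesis .
    qed
    then have "real m = (\<Prod>l\<in>?P. real l ^ multiplicity l m)"
      by (metis (no_types, lifting) of_nat_power of_nat_prod prod.cong)
    then show ?thesis
      by (simp add: power_mult mult.commute[of 2] flip: prod_power_distrib)
  qed
  then have "(\<Prod>l\<in>?P. local_factor m k l) = prod t ?P / ((real m)\<^sup>2 * prod f ?P)"
    by (simp add: local_eq prod_dividef prod.distrib)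
  also have "\<dots> = prod t ?P * real N / real (order (AutoGroup (rank2_group m k)))"
  proof -
    \<comment> \<open>With \<open>M = m\<close>, \<open>K = k\<close> and \<open>W\<close> the
      product of \<open>f\<close>, the group order over the automorphism count is
      \<open>1 / (M\<^sup>2 * W)\<close>.\<close>
    have cancel: "T / (M\<^sup>2 * W) = T * (M\<^sup>2 * K) / (M ^ 4 * K * W)" if "M \<noteq> 0" "K \<noteq> 0" for T M K W :: real
      using that by (simp add: power2_eq_square power4_eq_xxxx)
    have "real (order (AutoGroup (rank2_group m k))) = real m ^ 4 * real k * prod f ?P"
      by (simp only: order_AutoGroup_rank2_group[OF mk] f_def[abs_def] P')
    moreover have "real N = (real m)\<^sup>2 * real k" by (simp add: N_def)
    ultimately show ?thesis
      using cancel[of "real m" "real k"] mk by (simp only: of_nat_eq_0_iff neq0_conv)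
  qed
  finally have "prodinf F * (\<Prod>l\<in>?P. local_factor m k l)
      = K_const m k * real (order (rank2_group m k)) / real (order (AutoGroup (rank2_group m k)))"
    by (simp add: K N)
  \<comment> \<open>\<open>F\<close> is \<open>1\<close> at the primes dividing \<open>N\<close>, so
    the local factors there enter as a finite modification of the convergent product.\<close>
  moreover have "(\<lambda>l. F l * (if l \<in> ?P then local_factor m k l else 1)) has_prod (prodinf F * (\<Prod>l\<in>?P. local_factor m k l))"
  proof (intro has_prod_mult has_prod_If_finite_set)
    show "F has_prod prodinf F"
      unfolding F_def by (intro convergent_prod_has_prod convergent_K_const)
  qed simp
  moreover have "(\<lambda>l. F l * (if l \<in> ?P then local_factor m k l else 1))
      = (\<lambda>l. if prime l then lim (matrix_density m k l) else 1)"
  proof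
    fix l
    show "F l * (if l \<in> ?P then local_factor m k l else 1) = (if prime l then lim (matrix_density m k l) else 1)"
      using lim[of l] P[of l] N(2)
      by (auto simp: F_def in_prime_factors_iff local_factor_def N_def[symmetric])
  qed
  ultimately show "(\<lambda>l. if prime l then lim (matrix_density m k l) else 1) has_prod
           (K_const m k * real (order (rank2_group m k)) / real (order (AutoGroup (rank2_group m k))))"
    by simp
qed

end
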